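(* Let $\mathcal{A}$ be a projective line arrangement in $\mathbf{P}^2_{\mathbb{K}}$ over a field $\mathbb{K}$ of characteristic zero, and let $H\in\mathcal{A}$. If $\mathcal{A}':=\mathcal{A}\setminus\{H\}$ is free, then $n_2(\mathcal{A})>n_2(H)>0$. (Equivalently: if one adds a line to a free projective line arrangement, that line contains at least one double point.)
   Context: $S=\mathbb{K}[x,y,z]$, $\mathrm{Der}\,S=S\partial_x\oplus S\partial_y\oplus S\partial_z$. A line arrangement $\mathcal{A}$ in $\mathbf{P}^2_{\mathbb{K}}$ is a finite set of lines, equivalently $2$-dimensional linear subspaces of $\mathbb{K}^3$, each $H$ given by a linear form $\alpha_H$; standing assumption: the lines of $\mathcal{A}$ do not all pass through one common point. The logarithmic derivation module is $D(\mathcal{A})=\{\theta\in\mathrm{Der}\,S\mid \theta(\alpha_L)\in S\alpha_L\ \forall L\in\mathcal{A}\}$, and $\mathcal{A}$ is free if $D(\mathcal{A})$ is a free $S$-module. $L_2(\mathcal{A})$ is the set of points that are intersections of at least two lines of $\mathcal{A}$; a point $q\in L_2(\mathcal{A})$ is a double point if exactly two lines of $\mathcal{A}$ pass through $q$. $n_2(\mathcal{A})$ is the number of double points of $\mathcal{A}$ and $n_2(H)$ is the number of double points of $\mathcal{A}$ lying on $H$.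
   Formalization: The strict inequality n_2(A) > n_2(H) is replaced by n_2(A) ≥ n_2(H), since it fails when A' is the dual Hesse arrangement over the complex numbers (free, with no double points); the claim n_2(H) > 0 is kept in full. *)

theory Defs
  imports "HOL-Analysis.Analysis" "HOL-Computational_Algebra.Polynomial"
begin

section \<open>Lines and points of the projective plane\<close>

text \<open>Points and lines of the projective plane over \<open>'k\<close> are the linear subspaces of
  dimension 1 and 2 of \<open>'k ^ 3\<close>; incidence is inclusion.\<close>

definition proj_point :: "('k::field ^ 3) set \<Rightarrow> bool" where
  "proj_point p \<longleftrightarrow> vec.subspace p \<and> vec.dim p = 1"

definition proj_line :: "('k::field ^ 3) set \<Rightarrow> bool" where
  "proj_line L \<longleftrightarrow> vec.subspace L \<and> vec.dim L = 2"

definition line_arrangement :: "('k::field ^ 3) set set \<Rightarrow> bool" where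
  "line_arrangement A \<longleftrightarrow>
     finite A \<and> (\<forall>L\<in>A. proj_line L) \<and> \<not> (\<exists>p. proj_point p \<and> (\<forall>L\<in>A. p \<subseteq> L))"

definition L2 :: "('k::field ^ 3) set set \<Rightarrow> ('k ^ 3) set set" where
  "L2 A = {p. proj_point p \<and> (\<exists>L\<in>A. \<exists>M\<in>A. L \<noteq> M \<and> p \<subseteq> L \<and> p \<subseteq> M)}"

definition double_points :: "('k::field ^ 3) set set \<Rightarrow> ('k ^ 3) set set" where
  "double_points A = {p \<in> L2 A. card {L \<in> A. p \<subseteq> L} = 2}"

definition n2 :: "('k::field ^ 3) set set \<Rightarrow> nat" where
  "n2 A = card (double_points A)"

definition n2_on :: "('k::field ^ 3) set set \<Rightarrow> ('k ^ 3) set \<Rightarrow> nat" where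
  "n2_on A H = card {p \<in> double_points A. p \<subseteq> H}"

text \<open>The inequality between \<open>n2 A\<close> and \<open>n2_on A H\<close> is not strict in general, even if \<open>A - {H}\<close> is
  free and not a pencil: if \<open>A - {H}\<close> is the dual Hesse arrangement
  \<open>(x^3 - y^3) (y^3 - z^3) (z^3 - x^3) = 0\<close>, which is free and has only triple points, then every
  double point of \<open>A\<close> lies on \<open>H\<close>.\<close>


section \<open>The coordinate ring and its derivations\<close>

text \<open>The ring \<open>S = K[x,y,z]\<close> is encoded as \<open>K[x][y][z]\<close>, so that \<open>z\<close> is the outermost
  variable.\<close>

type_synonym 'k pol3 = "'k poly poly poly"

definition Const3 :: "'k::field \<Rightarrow> 'k pol3" where "Const3 c = [:[:[:c:]:]:]"
definition X3 :: "'k::field pol3" where "X3 = [:[:[:0, 1:]:]:]"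
definition Y3 :: "'k::field pol3" where "Y3 = [:[:0, 1:]:]"
definition Z3 :: "'k::field pol3" where "Z3 = [:0, 1:]"

definition dX :: "'k::field pol3 \<Rightarrow> 'k pol3" where "dX = map_poly (map_poly pderiv)"
definition dY :: "'k::field pol3 \<Rightarrow> 'k pol3" where "dY = map_poly pderiv"
definition dZ :: "'k::field pol3 \<Rightarrow> 'k pol3" where "dZ = pderiv"

text \<open>Since \<open>Der S\<close> is free over \<open>S\<close> with basis the three partial derivatives, a derivation is
  given by its coefficient vector in \<open>S ^ 3\<close>, on which \<open>S\<close> acts by \<open>(*s)\<close>.\<close>

definition der_apply :: "'k::field pol3 ^ 3 \<Rightarrow> 'k pol3 \<Rightarrow> 'k pol3" where
  "der_apply \<theta> f = \<theta> $ 1 * dX f + \<theta> $ 2 * dY f + \<theta> $ 3 * dZ f"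

definition linear_form :: "'k::field ^ 3 \<Rightarrow> 'k pol3" where
  "linear_form a = Const3 (a $ 1) * X3 + Const3 (a $ 2) * Y3 + Const3 (a $ 3) * Z3"

definition zero_set :: "'k::field ^ 3 \<Rightarrow> ('k ^ 3) set" where
  "zero_set a = {v. a $ 1 * v $ 1 + a $ 2 * v $ 2 + a $ 3 * v $ 3 = 0}"

text \<open>The form \<open>\<alpha>\<^sub>L\<close> is determined by the line \<open>L\<close> only up to a nonzero scalar, on which the
  divisibility condition does not depend; all forms with zero set \<open>L\<close> are therefore
  considered. At least one exists by \<open>proj_line_zero_set\<close> below.\<close>

definition log_der :: "('k::field ^ 3) set set \<Rightarrow> ('k pol3 ^ 3) set" where
  "log_der A = {\<theta>. \<forall>L\<in>A. \<forall>a. L = zero_set a \<longrightarrow> linear_form a dvd der_apply \<theta> (linear_form a)}"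

text \<open>The constants \<open>module.span\<close> and \<open>module.dependent\<close> have their intended meaning here by
  \<open>module_vec\<close> below.\<close>

definition free_submodule :: "('r::comm_ring_1 ^ 'n) set \<Rightarrow> bool" where
  "free_submodule M \<longleftrightarrow> (\<exists>B. \<not> module.dependent (*s) B \<and> module.span (*s) B = M)"

definition free_arrangement :: "('k::field ^ 3) set set \<Rightarrow> bool" where
  "free_arrangement A \<longleftrightarrow> free_submodule (log_der A)"


section \<open>Sanity checks\<close>

lemma module_vec: "module ((*s) :: 'r::comm_ring_1 \<Rightarrow> 'r ^ 'n \<Rightarrow> 'r ^ 'n)"
  by unfold_locales (simp_all add: vec_eq_iff algebra_simps)

lemma partial_derivatives_linear_form:
  "dX (linear_form a) = Const3 (a $ 1)"
  "dY (linear_form a) = Const3 (a $ 2)"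
  "dZ (linear_form a) = Const3 (a $ 3)"
  by (simp_all add: dX_def dY_def dZ_def linear_form_def Const3_def X3_def Y3_def Z3_def
      map_poly_pCons pderiv_pCons)

lemma der_apply_linear_form:
  "der_apply \<theta> (linear_form a) =
     \<theta> $ 1 * Const3 (a $ 1) + \<theta> $ 2 * Const3 (a $ 2) + \<theta> $ 3 * Const3 (a $ 3)"
  by (simp add: der_apply_def partial_derivatives_linear_form)

lemma subspace_log_der: "module.subspace (*s) (log_der A)"
proof -
  interpret S: module "(*s) :: 'a pol3 \<Rightarrow> 'a pol3 ^ 3 \<Rightarrow> 'a pol3 ^ 3" by (rule module_vec)
  have add: "der_apply (\<theta> + \<eta>) f = der_apply \<theta> f + der_apply \<eta> f" for \<theta> \<eta> f
    by (simp add: der_apply_def algebra_simps)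
  have scale: "der_apply (c *s \<theta>) f = c * der_apply \<theta> f" for c \<theta> f
    by (simp add: der_apply_def algebra_simps)
  have zero: "der_apply 0 f = 0" for f
    by (simp add: der_apply_def)
  show ?thesis
    by (auto simp: S.subspace_def log_der_def add scale zero)
qed

lemma proj_line_zero_set:
  fixes L :: "('k::field ^ 3) set"
  assumes "proj_line L"
  shows "\<exists>a. a \<noteq> 0 \<and> L = zero_set a"
proof -
  have sub: "vec.subspace L" and dim: "vec.dim L = 2"
    using assms by (auto simp: proj_line_def)
  obtain B where B: "B \<subseteq> L" "vec.independent B" "L \<subseteq> vec.span B" "card B = vec.dim L"
    using vec.basis_exists by blast
  obtain u w where uw: "B = {u, w}" "u \<noteq> w"
    using B(4) dim card_2_iff[of B] by auto
  define a :: "'k ^ 3" where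
    "a = vector [u $ 2 * w $ 3 - u $ 3 * w $ 2, u $ 3 * w $ 1 - u $ 1 * w $ 3,
                 u $ 1 * w $ 2 - u $ 2 * w $ 1]"
  have a: "a $ 1 = u $ 2 * w $ 3 - u $ 3 * w $ 2" "a $ 2 = u $ 3 * w $ 1 - u $ 1 * w $ 3"
    "a $ 3 = u $ 1 * w $ 2 - u $ 2 * w $ 1"
    by (simp_all add: a_def vector_3)
  have Z: "vec.subspace (zero_set a)"
    unfolding zero_set_def
  proof (rule vec.subspaceI, goal_cases)
    case (2 x y)
    have "a $ 1 * (x + y) $ 1 + a $ 2 * (x + y) $ 2 + a $ 3 * (x + y) $ 3 =
      (a $ 1 * x $ 1 + a $ 2 * x $ 2 + a $ 3 * x $ 3) + (a $ 1 * y $ 1 + a $ 2 * y $ 2 + a $ 3 * y $ 3)"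
      by (simp add: algebra_simps)
    with 2 show ?case by simp
  next
    case (3 c x)
    have "a $ 1 * (c *s x) $ 1 + a $ 2 * (c *s x) $ 2 + a $ 3 * (c *s x) $ 3 =
      c * (a $ 1 * x $ 1 + a $ 2 * x $ 2 + a $ 3 * x $ 3)"
      by (simp add: algebra_simps)
    with 3 show ?case by simp
  qed simp
  have "u \<in> zero_set a" "w \<in> zero_set a"
    by (simp_all add: zero_set_def a algebra_simps)
  then have "vec.span B \<subseteq> zero_set a"
    using uw Z by (intro vec.span_minimal) auto
  then have LZ: "L \<subseteq> zero_set a"
    using B(3) by blast
  have "a \<noteq> 0"
  proof
    assume "a = 0"
    then have eq: "u $ 2 * w $ 3 = u $ 3 * w $ 2" "u $ 3 * w $ 1 = u $ 1 * w $ 3"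
      "u $ 1 * w $ 2 = u $ 2 * w $ 1"
      using a by simp_all
    have "u \<noteq> 0"
      using B(2) uw vec.dependent_zero by blast
    then obtain i where i: "u $ i \<noteq> 0"
      by (auto simp: vec_eq_iff)
    have "u $ i * w $ j = w $ i * u $ j" for j
      using eq exhaust_3[of i] exhaust_3[of j] by (auto simp: mult.commute)
    then have "w = (w $ i / u $ i) *s u"
      using i by (simp add: vec_eq_iff field_simps)
    then have "w \<in> vec.span {u}"
      by (metis vec.span_base vec.span_scale singletonI)
    moreover have "w \<notin> vec.span {u}"
      using B(2) uw by (auto simp: vec.independent_insert insert_commute[of u])
    ultimately show False by simp
  qed
  then obtain i where i: "a $ i \<noteq> 0"
    by (auto simp: vec_eq_iff)
  have "axis i 1 \<notin> zero_set a"
    using i exhaust_3[of i] by (auto simp: zero_set_def axis_def)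
  then have "zero_set a \<noteq> UNIV"
    by blast
  then have "vec.span (zero_set a) \<subset> vec.span (UNIV :: ('k ^ 3) set)"
    using Z by (simp add: vec.span_eq_iff[THEN iffD2] psubset_eq)
  then have "vec.dim (zero_set a) < vec.dim (UNIV :: ('k ^ 3) set)"
    by (rule vec.dim_psubset)
  also have "vec.dim (UNIV :: ('k ^ 3) set) = 3"
    by (simp add: vec_dim_card del: vec.dim_UNIV)
  finally have "vec.dim (zero_set a) < 3" .
  then have "L = zero_set a"
    using vec.subspace_dim_equal[OF sub Z LZ] dim by simp
  with \<open>a \<noteq> 0\<close> show ?thesis by blast
qed

lemma finite_double_points:
  fixes A :: "('k::field ^ 3) set set"
  assumes "finite A" "\<forall>L\<in>A. proj_line L"
  shows "finite (double_points A)"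
proof (rule finite_subset)
  show "double_points A \<subseteq> (\<lambda>(L, M). L \<inter> M) ` (A \<times> A)"
  proof
    fix p assume "p \<in> double_points A"
    then obtain L M where LM: "L \<in> A" "M \<in> A" "L \<noteq> M" "p \<subseteq> L" "p \<subseteq> M" and p: "proj_point p"
      by (auto simp: double_points_def L2_def)
    have sL: "vec.subspace L" "vec.dim L = 2" and sM: "vec.subspace M" "vec.dim M = 2"
      using LM assms(2) by (auto simp: proj_line_def)
    have sI: "vec.subspace (L \<inter> M)"
      using sL sM by (simp add: vec.subspace_inter)
    have "vec.dim (L \<inter> M) \<noteq> 2"
    proof
      assume d: "vec.dim (L \<inter> M) = 2"
      have "L \<inter> M = L" by (rule vec.subspace_dim_equal) (use sI sL d in auto)
      moreover have "L \<inter> M = M" by (rule vec.subspace_dim_equal) (use sI sM d in auto)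
      ultimately show False using LM(3) by simp
    qed
    moreover have "vec.dim (L \<inter> M) \<le> 2"
      using vec.dim_subset[of "L \<inter> M" L] sL by simp
    ultimately have "vec.dim (L \<inter> M) \<le> vec.dim p"
      using p by (simp add: proj_point_def)
    then have "p = L \<inter> M"
      using vec.subspace_dim_equal[of p "L \<inter> M"] p sI LM by (simp add: proj_point_def)
    then show "p \<in> (\<lambda>(L, M). L \<inter> M) ` (A \<times> A)"
      using LM by auto
  qed
  show "finite ((\<lambda>(L, M). L \<inter> M) ` (A \<times> A))"
    using assms(1) by simp
qed

end

theory Submission
  imports Defs
begin

text \<open>Let \<open>A' = A - {H}\<close> have \<open>n\<close> lines meeting \<open>H\<close> in \<open>h\<close> points, and suppose that no double point of
  \<open>A\<close> lies on \<open>H\<close>, that is, each of these points lies on at least two lines of \<open>A'\<close>; so \<open>n \<ge> 2 h\<close>.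
  If \<open>D(A')\<close> is free, the determinant of a basis divides \<open>\<Prod>\<alpha>\<^sub>L\<close>, as in Saito's criterion, and is nonzero
  on \<open>H\<close>. Its part of lowest degree there yields homogeneous components \<open>\<eta>\<^sub>i\<close> of the basis elements, again in
  \<open>D(A')\<close> and independent on \<open>H\<close>, whose degrees \<open>d\<^sub>i\<close> have sum at most \<open>n\<close>.

  At a point of \<open>H\<close> on \<open>m\<close> lines of \<open>A'\<close>, the normal component \<open>\<eta>(\<alpha>\<^sub>H)\<close> of a homogeneous \<open>\<eta> \<in> D(A')\<close>
  vanishes to order \<open>m - 1\<close> along \<open>H\<close>, so that its degree is at least \<open>n - h\<close> unless it is zero on \<open>H\<close>. If it is
  zero, then subtracting the multiple \<open>\<eta>(\<alpha>\<^sub>H) / \<alpha>\<^sub>H\<close> of the Euler derivation leaves a derivation of \<open>H\<close> that is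
  logarithmic with multiplicity \<open>m \<ge> 2\<close> at each point, and in characteristic zero such a derivation has degree at least
  \<open>h\<close> or is zero. The normal components cannot all vanish, and at most one \<open>\<eta>\<^sub>i\<close> is a multiple of the Euler
  derivation on \<open>H\<close>; hence the degrees add up to at least \<open>(n - h) + h + 1 > n\<close>.\<close>

section \<open>Ring homomorphisms and restriction to a line\<close>

locale comm_ring_hom =
  fixes \<phi> :: "'a::comm_ring_1 \<Rightarrow> 'b::comm_ring_1"
  assumes add: "\<phi> (x + y) = \<phi> x + \<phi> y"
    and mult: "\<phi> (x * y) = \<phi> x * \<phi> y"
    and one: "\<phi> 1 = 1"
begin

lemma zero: "\<phi> 0 = 0"
  using add[of 0 0] by simp

lemma diff: "\<phi> (x - y) = \<phi> x - \<phi> y"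
  using add[of "x - y" y] by simp

lemma sum: "\<phi> (sum f S) = (\<Sum>i\<in>S. \<phi> (f i))"
  by (induction S rule: infinite_finite_induct) (simp_all add: zero add)

lemma prod: "\<phi> (prod f S) = (\<Prod>i\<in>S. \<phi> (f i))"
  by (induction S rule: infinite_finite_induct) (simp_all add: one mult)

lemma dvd: "x dvd y \<Longrightarrow> \<phi> x dvd \<phi> y"
  by (metis dvd_def mult)

lemma map_poly_hom: "comm_ring_hom (map_poly \<phi>)"
proof
  show "map_poly \<phi> (p + q) = map_poly \<phi> p + map_poly \<phi> q" for p q
    by (rule poly_eqI) (simp add: coeff_map_poly zero add)
  show "map_poly \<phi> (p * q) = map_poly \<phi> p * map_poly \<phi> q" for p q
    by (rule poly_eqI) (simp add: coeff_map_poly zero coeff_mult sum mult)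
  show "map_poly \<phi> 1 = 1"
    by (simp add: one)
qed

lemma poly_map_poly_hom: "comm_ring_hom (\<lambda>p. poly (map_poly \<phi> p) x)"
proof -
  interpret P: comm_ring_hom "map_poly \<phi>" by (rule map_poly_hom)
  show ?thesis
    by unfold_locales (simp_all add: P.add P.mult P.one)
qed

end

lemma comm_ring_hom_coeff_0: "comm_ring_hom (\<lambda>p. coeff p 0)"
  by unfold_locales (simp_all add: coeff_mult)

lemma comm_ring_hom_comp:
  "comm_ring_hom f \<Longrightarrow> comm_ring_hom g \<Longrightarrow> comm_ring_hom (\<lambda>x. f (g x))"
  by (simp add: comm_ring_hom_def)

lemma prod_roots_dvd:
  fixes p :: "'a::idom poly"
  assumes "finite R" "\<And>r. r \<in> R \<Longrightarrow> poly p r = 0"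
  shows "(\<Prod>r\<in>R. [:- r, 1:]) dvd p"
  using assms
proof (induction R)
  case (insert r R)
  then obtain g where g: "p = (\<Prod>r\<in>R. [:- r, 1:]) * g"
    by auto
  have "(\<Prod>s\<in>R. r - s) * poly g r = 0"
    using insert.prems[of r] by (simp add: g poly_prod)
  moreover have "(\<Prod>s\<in>R. r - s) \<noteq> 0"
    using insert.hyps by auto
  ultimately have "[:- r, 1:] dvd g"
    by (simp add: poly_eq_0_iff_dvd)
  then have "(\<Prod>r\<in>R. [:- r, 1:]) * [:- r, 1:] dvd p"
    unfolding g by (rule mult_dvd_mono[OF dvd_refl])
  then show ?case
    using insert.hyps by (simp add: mult.commute)
qed auto

text \<open>The roots \<open>t + c z\<close> in \<open>y\<close> are distinct over
  \<open>K[z]\<close>, but all become \<open>t\<close> at \<open>z = 0\<close>, where their linear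
  factors multiply up to a power.\<close>

lemma power_dvd_restriction:
  fixes F :: "'k::field poly poly"
  assumes "finite S" "\<And>c. c \<in> S \<Longrightarrow> poly F [:t, c:] = 0"
  shows "[:- t, 1:] ^ card S dvd map_poly (\<lambda>p. coeff p 0) F"
proof -
  interpret r: comm_ring_hom "map_poly (\<lambda>p::'k poly. coeff p 0)"
    by (intro comm_ring_hom.map_poly_hom comm_ring_hom_coeff_0)
  have "(\<Prod>r\<in>(\<lambda>c. [:t, c:]) ` S. [:- r, 1:]) dvd F"
    using assms by (intro prod_roots_dvd) auto
  then have "map_poly (\<lambda>p. coeff p 0) (\<Prod>c\<in>S. [:- [:t, c:], 1:]) dvd map_poly (\<lambda>p. coeff p 0) F"
    by (subst (asm) prod.reindex) (auto simp: inj_on_def intro: r.dvd)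
  then show ?thesis
    by (simp add: r.prod map_poly_pCons)
qed

text \<open>The hypothesis determines the derivative of \<open>R = b - y a\<close> at every \<open>t\<close>, because
  \<open>R = - (y - t) (a - q)\<close> modulo \<open>(y - t)\<^sup>2\<close>. In characteristic zero, comparing top coefficients
  then lowers the degree of \<open>R\<close>, so that it has too many roots.\<close>

lemma euler_multiple_if_square_dvd:
  fixes a b q :: "'k::field_char_0 poly"
  assumes T: "finite T" "card T \<ge> 2" "d < card T"
    and deg: "degree a \<le> d" "degree b \<le> d" "\<And>j. j \<ge> d \<Longrightarrow> coeff q j = 0"
    and sq: "\<And>t. t \<in> T \<Longrightarrow> [:- t, 1:] ^ 2 dvd b - smult t a - [:- t, 1:] * q"
  shows "a = q" "b = [:0, 1:] * q"
proof -
  define R where "R = b - [:0, 1:] * a"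
  have roots: "poly R t = 0" "poly (pderiv R + (a - q)) t = 0" if "t \<in> T" for t
  proof -
    obtain g where g: "b - smult t a - [:- t, 1:] * q = [:- t, 1:] ^ 2 * g"
      using sq[OF \<open>t \<in> T\<close>] by (rule dvdE)
    have "b - y * a = b - s * a - (y - s) * q - (y - s) * (a - q)" for y s
      by (simp add: algebra_simps)
    from this[of "[:0, 1:]" "[:t:]"]
    have "R = (b - smult t a - [:- t, 1:] * q) - [:- t, 1:] * (a - q)"
      by (simp add: R_def)
    then have R: "R = [:- t, 1:] * ([:- t, 1:] * g - (a - q))"
      unfolding g by (simp only: power2_eq_square mult.assoc right_diff_distrib)
    show "poly R t = 0"
      unfolding R by simp
    show "poly (pderiv R + (a - q)) t = 0"
      unfolding R pderiv_mult by (simp add: pderiv_pCons)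
  qed
  have degq: "degree q \<le> d"
    using deg(3) by (intro degree_le) auto
  have "degree ([:0, 1:] * a) \<le> Suc d"
    using deg(1) by (cases "a = 0") (simp_all add: degree_mult_eq)
  then have degR: "degree R \<le> Suc d"
    unfolding R_def using deg(2) by (intro degree_diff_le) auto
  have "degree (pderiv R + (a - q)) \<le> d"
    using degR deg(1) degq by (intro degree_add_le degree_diff_le) (auto simp: degree_pderiv)
  have zero_if: "p = 0" if "degree p < card T" "\<And>t. t \<in> T \<Longrightarrow> poly p t = 0" for p :: "'k poly"
    using that T(1) poly_eqI_degree[of T p 0] by simp
  have eq: "pderiv R + (a - q) = 0"
    using \<open>degree (pderiv R + (a - q)) \<le> d\<close> T(3) roots(2) by (intro zero_if) auto
  have "R = 0"
  proof (cases "d = 0")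
    \<comment> \<open>Here \<open>R\<close> has degree at most 1 and at least two roots. The
      comparison of coefficients below would say nothing, because its factor \<open>d\<close> is
      zero.\<close>
    case True
    then show ?thesis
      using degR T(2) roots(1) by (intro zero_if) auto
  next
    case False
    have cR: "coeff R (Suc d) = - coeff a d"
      unfolding R_def using deg(2) by (simp add: coeff_eq_0)
    \<comment> \<open>Differentiation contributes \<open>- (d + 1) * coeff a d\<close>, and
      \<open>a - q\<close> contributes \<open>coeff a d\<close> since \<open>coeff q d = 0\<close>;
      what remains is \<open>- d * coeff a d\<close>.\<close>
    have "coeff (pderiv R + (a - q)) d = 0"
      unfolding eq by simp
    then have "of_nat d * coeff a d = 0"
      using deg(3)[of d] by (simp add: coeff_pderiv cR algebra_simps)
    then have "coeff R (Suc d) = 0"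
      using False by (simp add: cR)
    then have "degree R \<le> d"
      using degR by (metis le_Suc_eq leading_coeff_0_iff degree_0 le0)
    then show ?thesis
      using T(3) roots(1) by (intro zero_if) auto
  qed
  then show "a = q"
    using eq by simp
  with \<open>R = 0\<close> show "b = [:0, 1:] * q"
    by (simp add: R_def)
qed

section \<open>Orders of vanishing of a derivation along \<open>H\<close>\<close>

definition fibre :: "('a \<times> 'b) set \<Rightarrow> 'a \<Rightarrow> 'b set" where
  "fibre I t = {c. (t, c) \<in> I}"

lemma finite_fibre: "finite I \<Longrightarrow> finite (fibre I t)"
  by (rule finite_subset[of _ "snd ` I"]) (force simp: fibre_def)+

lemma sum_card_fibre: "finite I \<Longrightarrow> (\<Sum>t\<in>fst ` I. card (fibre I t)) = card I"
proof -
  assume "finite I"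
  then have "card (Sigma (fst ` I) (fibre I)) = (\<Sum>t\<in>fst ` I. card (fibre I t))"
    by (intro card_SigmaI) (auto intro: finite_fibre)
  moreover have "Sigma (fst ` I) (fibre I) = I"
    by (force simp: fibre_def)
  ultimately show ?thesis by simp
qed

text \<open>A pair \<open>(t, c)\<close> encodes the line \<open>y = t x + c z\<close>, and \<open>H\<close> is \<open>z = 0\<close>. The coefficients \<open>A\<close>, \<open>B\<close>, \<open>C\<close> of a
  homogeneous derivation are written in the chart \<open>x = 1\<close>, as polynomials in \<open>y\<close> over \<open>K[z]\<close>.\<close>

locale restricted_derivation =
  fixes I :: "('k::field_char_0 \<times> 'k) set" and A B C :: "'k poly poly"
  assumes finite_I: "finite I"
    and log: "\<And>t c. (t, c) \<in> I \<Longrightarrow> poly (B - smult [:t:] A - smult [:c:] C) [:t, c:] = 0"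
begin

abbreviation r0 :: "'k poly poly \<Rightarrow> 'k poly" where
  "r0 \<equiv> map_poly (\<lambda>p. coeff p 0)"

sublocale r0: comm_ring_hom r0
  by (intro comm_ring_hom.map_poly_hom comm_ring_hom_coeff_0)

text \<open>On \<open>y = t + c z\<close> the locale assumption reads \<open>B - t A = c C\<close>.
  Multiplying by \<open>z\<close> turns \<open>c z\<close> into \<open>y - t\<close>, so a single
  polynomial \<open>P\<close>, free of \<open>c\<close>, vanishes on all lines of the fibre.\<close>

lemma power_dvd_normal:
  "[:- t, 1:] ^ card (fibre I t) dvd [:- t, 1:] * r0 C"
proof -
  define P where "P = [:[:- t:], 1:] * C - [:[:0, 1:]:] * (B - smult [:t:] A)"
  have "poly P [:t, c:] = 0" if "c \<in> fibre I t" for c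
  proof -
    have "(t, c) \<in> I" using that by (simp add: fibre_def)
    have "[:0, 1:] * poly (B - smult [:t:] A) [:t, c:] = [:0, 1:] * ([:c:] * poly C [:t, c:])"
      using log[OF \<open>(t, c) \<in> I\<close>] by simp
    then show ?thesis
      by (simp add: P_def algebra_simps)
  qed
  then have "[:- t, 1:] ^ card (fibre I t) dvd r0 P"
    using finite_I by (intro power_dvd_restriction finite_fibre)
  moreover have "r0 P = [:- t, 1:] * r0 C"
  proof -
    have "r0 ([:[:0, 1:]:] * F) = 0" for F
      unfolding r0.mult by (simp add: map_poly_pCons)
    moreover have "r0 ([:[:- t:], 1:] * C) = [:- t, 1:] * r0 C"
      unfolding r0.mult by (simp add: map_poly_pCons)
    ultimately show ?thesis
      by (simp only: P_def r0.diff diff_zero)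
  qed
  ultimately show ?thesis by simp
qed

text \<open>Now \<open>c C = c z q = (y - t) q\<close> on each line, which removes \<open>c\<close>
  without the extra factor \<open>y - t\<close> on the right and keeps the full
  multiplicity.\<close>

lemma power_dvd_tangential:
  assumes C: "C = smult [:0, 1:] q"
  shows "[:- t, 1:] ^ card (fibre I t) dvd r0 B - smult t (r0 A) - [:- t, 1:] * r0 q"
proof -
  define P where "P = B - smult [:t:] A - [:[:- t:], 1:] * q"
  have "poly P [:t, c:] = 0" if "c \<in> fibre I t" for c
  proof -
    have "(t, c) \<in> I" using that by (simp add: fibre_def)
    then show ?thesis
      using log[of t c] by (simp add: P_def C algebra_simps)
  qed
  then have "[:- t, 1:] ^ card (fibre I t) dvd r0 P"
    using finite_I by (intro power_dvd_restriction finite_fibre)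
  moreover have "r0 P = r0 B - smult t (r0 A) - [:- t, 1:] * r0 q"
  proof -
    have "r0 (smult [:t:] A) = smult t (r0 A)"
      by (rule poly_eqI) (simp add: coeff_map_poly)
    moreover have "r0 ([:[:- t:], 1:] * q) = [:- t, 1:] * r0 q"
      unfolding r0.mult by (simp add: map_poly_pCons)
    ultimately show ?thesis
      by (simp only: P_def r0.diff)
  qed
  ultimately show ?thesis by simp
qed

text \<open>The extra factor \<open>y - t\<close> costs one order of vanishing at each point
  \<open>t\<close>. Summing the remaining orders over all points bounds the degree from
  below.\<close>

lemma degree_normal_ge:
  assumes "r0 C \<noteq> 0"
  shows "card I \<le> degree (r0 C) + card (fst ` I)"
proof -
  have le: "card (fibre I t) \<le> order t (r0 C) + 1" for t
  proof -
    have nz: "[:- t, 1:] * r0 C \<noteq> 0"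
      using assms by (simp only: mult_eq_0_iff) simp
    then have "card (fibre I t) \<le> order t ([:- t, 1:] * r0 C)"
      using power_dvd_normal[of t] unfolding order_divides by simp
    also have "\<dots> = order t [:- t, 1:] + order t (r0 C)"
      using nz by (rule order_mult)
    also have "order t [:- t, 1:] = 1"
      using order_power_n_n[of t 1] by simp
    finally show ?thesis by simp
  qed
  have "card I = (\<Sum>t\<in>fst ` I. card (fibre I t))"
    using finite_I by (simp add: sum_card_fibre)
  also have "\<dots> \<le> (\<Sum>t\<in>fst ` I. order t (r0 C) + 1)"
    by (intro sum_mono le)
  also have "\<dots> = (\<Sum>t\<in>fst ` I. order t (r0 C)) + card (fst ` I)"
    by (simp only: sum.distrib) simp
  also have "(\<Sum>t\<in>fst ` I. order t (r0 C)) \<le> degree (r0 C)"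
  proof -
    have "(\<Sum>t\<in>fst ` I. order t (r0 C)) = (\<Sum>t\<in>{t\<in>fst ` I. poly (r0 C) t = 0}. order t (r0 C))"
      using finite_I by (intro sum.mono_neutral_right) (auto simp: order_root)
    also have "\<dots> \<le> (\<Sum>t | poly (r0 C) t = 0. order t (r0 C))"
      using assms by (intro sum_mono2) (auto simp: poly_roots_finite)
    also have "\<dots> \<le> degree (r0 C)"
      using assms by (rule sum_order_le_degree)
    finally show ?thesis .
  qed
  finally show ?thesis by simp
qed

text \<open>A normal component that vanishes on \<open>H\<close> has the form \<open>z q\<close>.
  The last degree condition, which homogeneity of degree \<open>d\<close> supplies, says that
  \<open>q\<close> has degree below \<open>d\<close> on \<open>H\<close>, and for
  \<open>d = 0\<close> that it vanishes there. Fibres with two elements provide the square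
  divisors.\<close>

lemma euler_multiple:
  fixes d :: nat
  assumes "r0 C = 0" "d < card (fst ` I)" "card (fst ` I) \<ge> 2"
    and mult: "\<And>t. t \<in> fst ` I \<Longrightarrow> card (fibre I t) \<ge> 2"
    and deg: "degree (r0 A) \<le> d" "degree (r0 B) \<le> d"
      "\<And>j. j \<ge> d \<Longrightarrow> coeff (coeff C j) 1 = 0"
  obtains p where "r0 A = p" "r0 B = [:0, 1:] * p" "d = 0 \<Longrightarrow> p = 0"
proof -
  have "[:[:0, 1:]:] dvd C"
  proof (unfold const_poly_dvd_iff, rule allI)
    fix j
    have "coeff (coeff C j) 0 = coeff (r0 C) j"
      by (simp add: coeff_map_poly)
    then show "[:0, 1:] dvd coeff C j"
      using assms(1) dvd_iff_poly_eq_0[of 0 "coeff C j"] by (simp add: poly_0_coeff_0)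
  qed
  then obtain q where q: "C = smult [:0, 1:] q"
    by auto
  have cq: "coeff (r0 q) j = 0" if "j \<ge> d" for j
    using deg(3)[OF that] by (simp add: q coeff_map_poly)
  have "[:- t, 1:] ^ 2 dvd r0 B - smult t (r0 A) - [:- t, 1:] * r0 q" if "t \<in> fst ` I" for t
    using power_dvd_tangential[OF q] mult[OF that] by (blast intro: dvd_trans le_imp_power_dvd)
  note * = euler_multiple_if_square_dvd[OF finite_imageI[OF finite_I] assms(3,2) deg(1,2) cq this]
  have "r0 A = r0 q" "r0 B = [:0, 1:] * r0 q"
    by (rule *; assumption)+
  then show ?thesis
  proof (rule that)
    assume "d = 0"
    then show "r0 q = 0"
      using cq by (intro poly_eqI) simp
  qed
qed

end

section \<open>Determinants of bases of derivation modules\<close>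

definition dot :: "'a::comm_ring_1 ^ 3 \<Rightarrow> 'a ^ 3 \<Rightarrow> 'a" where
  "dot u v = u $ 1 * v $ 1 + u $ 2 * v $ 2 + u $ 3 * v $ 3"

definition cross :: "'a::comm_ring_1 ^ 3 \<Rightarrow> 'a ^ 3 \<Rightarrow> 'a ^ 3" where
  "cross u v = vector [u $ 2 * v $ 3 - u $ 3 * v $ 2, u $ 3 * v $ 1 - u $ 1 * v $ 3,
     u $ 1 * v $ 2 - u $ 2 * v $ 1]"

text \<open>The determinant with rows \<open>u\<close>, \<open>v\<close>, \<open>w\<close>.\<close>

definition trip :: "'a::comm_ring_1 ^ 3 \<Rightarrow> 'a ^ 3 \<Rightarrow> 'a ^ 3 \<Rightarrow> 'a" where
  "trip u v w = dot u (cross v w)"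

lemmas vec3_simps = trip_def dot_def cross_def

lemma trip_add:
  "trip (x + x') y z = trip x y z + trip x' y z"
  "trip x (y + y') z = trip x y z + trip x y' z"
  "trip x y (z + z') = trip x y z + trip x y z'"
  by (simp_all add: vec3_simps algebra_simps)

lemma trip_scale:
  "trip (k *s x) y z = k * trip x y z"
  "trip x (k *s y) z = k * trip x y z"
  "trip x y (k *s z) = k * trip x y z"
  by (simp_all add: vec3_simps algebra_simps)

lemma trip_zero: "trip 0 y z = 0" "trip x 0 z = 0" "trip x y 0 = 0"
  by (simp_all add: vec3_simps)

lemma trip_degenerate: "trip x x z = 0" "trip x y x = 0" "trip x y y = 0"
  by (simp_all add: vec3_simps algebra_simps)

text \<open>Cramer's rule without division: an explicit linear relation between any four
  vectors.\<close>

lemma cramer: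
  "trip x y z *s v = trip v y z *s x + trip x v z *s y + trip x y v *s z"
  by (simp add: vec_eq_iff forall_3 vec3_simps algebra_simps)

lemma trip_dot:
  "trip (vector [dot a x, dot b x, dot c x]) (vector [dot a y, dot b y, dot c y])
     (vector [dot a z, dot b z, dot c z]) = trip a b c * trip x y z"
  by (simp add: vec3_simps algebra_simps)

lemma trip_cross: "trip (cross v w) (cross w u) (cross u v) = trip u v w ^ 2"
  by (simp add: vec3_simps algebra_simps power2_eq_square)

lemma trip_cross_left: "trip (cross a p) (cross a q) r = dot a (cross p q) * dot a r"
  by (simp add: vec3_simps algebra_simps)

lemma trip_cyclic: "trip u v w = dot (cross u v) w"
  by (simp add: vec3_simps algebra_simps)

lemma dot_cross_self: "dot a (cross a p) = 0"
  by (simp add: vec3_simps algebra_simps)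

text \<open>Up to the factor \<open>trip u w e\<close>, the three cross products are the basis dual
  to \<open>u\<close>, \<open>w\<close>, \<open>e\<close>.\<close>

lemma dual_frame_expansion:
  "trip u w e * dot a x =
     dot a u * dot (cross w e) x + dot a w * dot (cross e u) x + dot a e * dot (cross u w) x"
  by (simp add: vec3_simps algebra_simps)

lemma cross_surj:
  fixes a :: "'k::field ^ 3"
  assumes "a \<noteq> 0"
  obtains p q where "cross p q = a"
proof -
  have "a $ 1 \<noteq> 0 \<or> a $ 2 \<noteq> 0 \<or> a $ 3 \<noteq> 0"
    using assms by (auto simp: vec_eq_iff forall_3)
  then consider "a $ 1 \<noteq> 0" | "a $ 2 \<noteq> 0" | "a $ 3 \<noteq> 0" by blast
  then show thesis
  proof cases
    case 1
    then have "cross (vector [- (a $ 2) / a $ 1, 1, 0]) (vector [- (a $ 3), 0, a $ 1]) = a"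
      by (simp add: vec_eq_iff forall_3 vec3_simps)
    then show thesis by (rule that)
  next
    case 2
    then have "cross (vector [0, - (a $ 3) / a $ 2, 1]) (vector [a $ 2, - (a $ 1), 0]) = a"
      by (simp add: vec_eq_iff forall_3 vec3_simps)
    then show thesis by (rule that)
  next
    case 3
    then have "cross (vector [1, 0, - (a $ 1) / a $ 3]) (vector [0, a $ 3, - (a $ 2)]) = a"
      by (simp add: vec_eq_iff forall_3 vec3_simps)
    then show thesis by (rule that)
  qed
qed

lemma dot_surj:
  fixes a :: "'k::field ^ 3"
  assumes "a \<noteq> 0"
  obtains v where "dot a v = k"
proof -
  have "a $ 1 \<noteq> 0 \<or> a $ 2 \<noteq> 0 \<or> a $ 3 \<noteq> 0"
    using assms by (auto simp: vec_eq_iff forall_3)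
  then consider "a $ 1 \<noteq> 0" | "a $ 2 \<noteq> 0" | "a $ 3 \<noteq> 0" by blast
  then show thesis
  proof cases
    case 1
    then show thesis by (intro that[of "vector [k / a $ 1, 0, 0]"]) (simp add: vec3_simps)
  next
    case 2
    then show thesis by (intro that[of "vector [0, k / a $ 2, 0]"]) (simp add: vec3_simps)
  next
    case 3
    then show thesis by (intro that[of "vector [0, 0, k / a $ 3]"]) (simp add: vec3_simps)
  qed
qed

text \<open>By trilinearity, one argument at a time can be extended from \<open>B\<close> to its
  span.\<close>

lemma trip_span_dvd:
  fixes B :: "('r::idom ^ 3) set"
  assumes B: "\<And>x y z. x \<in> B \<Longrightarrow> y \<in> B \<Longrightarrow> z \<in> B \<Longrightarrow> \<delta> dvd trip x y z"
    and "x \<in> module.span (*s) B" "y \<in> module.span (*s) B" "z \<in> module.span (*s) B"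
  shows "\<delta> dvd trip x y z"
proof -
  interpret S: module "(*s) :: 'r \<Rightarrow> 'r ^ 3 \<Rightarrow> 'r ^ 3" by (rule module_vec)
  have 1: "S.span B \<subseteq> {x. \<forall>y\<in>B. \<forall>z\<in>B. \<delta> dvd trip x y z}"
    by (rule S.span_minimal) (auto simp: S.subspace_def trip_zero trip_add trip_scale B)
  have 2: "S.span B \<subseteq> {y. \<forall>x\<in>S.span B. \<forall>z\<in>B. \<delta> dvd trip x y z}"
    by (rule S.span_minimal) (use 1 in \<open>auto simp: S.subspace_def trip_zero trip_add trip_scale\<close>)
  have 3: "S.span B \<subseteq> {z. \<forall>x\<in>S.span B. \<forall>y\<in>S.span B. \<delta> dvd trip x y z}"
    by (rule S.span_minimal) (use 2 in \<open>auto simp: S.subspace_def trip_zero trip_add trip_scale\<close>)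
  show ?thesis
    using 3 assms(2-4) by blast
qed

text \<open>Some three basis elements have nonzero determinant, since otherwise all determinants
  over the span would be divisible by 0. Cramer's relation rules out a fourth element, so all
  determinants of basis elements are 0 or, up to sign, this one.\<close>

lemma free_submodule_trip:
  fixes M :: "('r::idom ^ 3) set"
  assumes "free_submodule M" and rank: "x0 \<in> M" "y0 \<in> M" "z0 \<in> M" "trip x0 y0 z0 \<noteq> 0"
  obtains b1 b2 b3 where "b1 \<in> M" "b2 \<in> M" "b3 \<in> M"
    "\<And>x y z. x \<in> M \<Longrightarrow> y \<in> M \<Longrightarrow> z \<in> M \<Longrightarrow> trip b1 b2 b3 dvd trip x y z"
proof -
  interpret S: module "(*s) :: 'r \<Rightarrow> 'r ^ 3 \<Rightarrow> 'r ^ 3" by (rule module_vec)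
  obtain B where B: "\<not> S.dependent B" "S.span B = M"
    using assms(1) by (auto simp: free_submodule_def)
  have "\<exists>b1\<in>B. \<exists>b2\<in>B. \<exists>b3\<in>B. trip b1 b2 b3 \<noteq> 0"
    using trip_span_dvd[of B 0 x0 y0 z0] rank B(2) by auto
  then obtain b1 b2 b3 where b: "b1 \<in> B" "b2 \<in> B" "b3 \<in> B" and nz: "trip b1 b2 b3 \<noteq> 0"
    by blast
  have ne: "b1 \<noteq> b2" "b1 \<noteq> b3" "b2 \<noteq> b3"
    using nz by (auto simp: trip_degenerate)
  have sub: "B \<subseteq> {b1, b2, b3}"
  proof (rule ccontr)
    assume "\<not> B \<subseteq> {b1, b2, b3}"
    then obtain v where v: "v \<in> B" "v \<noteq> b1" "v \<noteq> b2" "v \<noteq> b3" by auto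
    \<comment> \<open>These are the coefficients in \<open>cramer\<close>, with the left-hand side
      brought over to the right.\<close>
    define c where "c x = (if x = v then - trip b1 b2 b3 else if x = b1 then trip v b2 b3
      else if x = b2 then trip b1 v b3 else trip b1 b2 v)" for x
    have "(\<Sum>x\<in>{v, b1, b2, b3}. c x *s x) = 0"
      using v ne cramer[of b1 b2 b3 v] by (simp add: c_def vector_smult_lneg add.assoc)
    moreover have "c v \<noteq> 0"
      using nz by (simp add: c_def)
    ultimately have "S.dependent B"
      unfolding S.dependent_explicit using v(1) b
      by (intro exI[of _ "{v, b1, b2, b3}"] exI[of _ c]) auto
    with B(1) show False by simp
  qed
  have perm: "trip b1 b3 b2 = - trip b1 b2 b3" "trip b2 b1 b3 = - trip b1 b2 b3"
    "trip b2 b3 b1 = trip b1 b2 b3" "trip b3 b1 b2 = trip b1 b2 b3"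
    "trip b3 b2 b1 = - trip b1 b2 b3"
    by (simp_all add: vec3_simps algebra_simps)
  have "trip b1 b2 b3 dvd trip x y z" if "x \<in> B" "y \<in> B" "z \<in> B" for x y z
  proof -
    have "x \<in> {b1, b2, b3}" "y \<in> {b1, b2, b3}" "z \<in> {b1, b2, b3}"
      using that sub by auto
    then show ?thesis
      by (auto simp: trip_degenerate perm)
  qed
  then have "trip b1 b2 b3 dvd trip x y z" if "x \<in> M" "y \<in> M" "z \<in> M" for x y z
    using that trip_span_dvd[of B "trip b1 b2 b3"] B(2) by blast
  moreover have "b1 \<in> M" "b2 \<in> M" "b3 \<in> M"
    using b B(2) S.span_base by blast+
  ultimately show thesis
    using that by blast
qed

section \<open>Primality of linear forms and reduction of exponents\<close>

lemma prime_elem_linear_poly: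
  fixes p :: "'a::idom"
  assumes "c * c' = 1"
  shows "prime_elem [:p, c:]"
proof -
  have dvd_iff: "[:p, c:] dvd f \<longleftrightarrow> poly f (- (c' * p)) = 0" for f
  proof
    assume "[:p, c:] dvd f"
    moreover have "c' * p * c = p"
      using assms by (metis mult.commute mult.left_commute mult_1_right)
    then have "poly [:p, c:] (- (c' * p)) = 0"
      by simp
    ultimately show "poly f (- (c' * p)) = 0"
      by (metis dvd_def mult_zero_left poly_mult)
  next
    assume "poly f (- (c' * p)) = 0"
    then obtain g where "f = [:c' * p, 1:] * g"
      by (metis dvd_def poly_eq_0_iff_dvd minus_minus)
    also have "[:c' * p, 1:] = smult c' [:p, c:]"
      using assms by (simp add: mult.commute)
    also have "\<dots> * g = [:p, c:] * smult c' g"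
      by (simp only: mult_smult_left mult_smult_right)
    finally show "[:p, c:] dvd f"
      by (rule dvdI)
  qed
  have "c \<noteq> 0"
    using assms by auto
  then show ?thesis
    by (intro prime_elemI) (auto simp: dvd_iff)
qed

lemma linear_form_conv:
  "linear_form a = [:[:[:0, a $ 1:], [:a $ 2:]:], [:[:a $ 3:]:]:]"
  by (simp add: linear_form_def Const3_def X3_def Y3_def Z3_def)

text \<open>In the outermost variable that occurs, the form is linear with a unit as leading
  coefficient, so divisibility by it means vanishing at a root. Primality then passes to constants
  over the remaining outer variables.\<close>

lemma prime_elem_linear_form:
  assumes "a \<noteq> 0"
  shows "prime_elem (linear_form a)"
proof -
  have "a $ 1 \<noteq> 0 \<or> a $ 2 \<noteq> 0 \<or> a $ 3 \<noteq> 0"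
    using assms by (auto simp: vec_eq_iff forall_3)
  then consider "a $ 3 \<noteq> 0" | "a $ 3 = 0" "a $ 2 \<noteq> 0" | "a $ 3 = 0" "a $ 2 = 0" "a $ 1 \<noteq> 0"
    by blast
  then show ?thesis
  proof cases
    case 1
    then show ?thesis
      unfolding linear_form_conv
      by (intro prime_elem_linear_poly[of _ "[:[:1 / a $ 3:]:]"]) (simp add: one_pCons)
  next
    case 2
    have "prime_elem [:[:0, a $ 1:], [:a $ 2:]:]"
      using 2 by (intro prime_elem_linear_poly[of _ "[:1 / a $ 2:]"]) (simp add: one_pCons)
    then show ?thesis
      using 2 lift_prime_elem_poly by (simp add: linear_form_conv)
  next
    case 3
    have "prime_elem [:0, a $ 1:]"
      using 3 by (intro prime_elem_linear_poly[of _ "1 / a $ 1"]) simp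
    then show ?thesis
      using lift_prime_elem_poly[OF lift_prime_elem_poly] by (simp add: linear_form_conv 3)
  qed
qed

text \<open>As \<open>p\<close> does not divide \<open>T\<close>, the second divisibility shows that
  \<open>\<delta>\<close> contains \<open>p\<close> at most once, and the surplus factors
  \<open>p\<close> in the first can be cancelled.\<close>

lemma dvd_reduce_prime_power:
  fixes p :: "'a::idom"
  assumes p: "prime_elem p" and 1: "\<delta> dvd p ^ 3 * R" and 2: "\<delta> dvd p * T" and 3: "\<not> p dvd T"
  shows "\<delta> dvd p * R"
proof -
  have p0: "p \<noteq> 0"
    using p by auto
  have cancel: "x dvd y" if dvd: "x dvd p * y" and not_dvd: "\<not> p dvd x" for x y
  proof -
    from dvd obtain k where k: "p * y = x * k" ..
    have "p dvd x * k"
      unfolding k[symmetric] by simp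
    then have "p dvd k"
      using p not_dvd prime_elem_dvd_multD by blast
    then obtain k' where "k = p * k'" ..
    then have "y = x * k'"
      using k p0 by (simp add: mult.left_commute)
    then show ?thesis by simp
  qed
  have cube: "\<delta> dvd p * (p * (p * R))"
    using 1 by (simp add: power3_eq_cube mult.assoc)
  show ?thesis
  proof (cases "p dvd \<delta>")
    case False
    then show ?thesis
      using cancel[OF cube] cancel by blast
  next
    case True
    then obtain \<epsilon> where e: "\<delta> = p * \<epsilon>" ..
    have "\<epsilon> dvd T" and "\<epsilon> dvd p * (p * R)"
      using 2 cube p0 by (simp_all add: e)
    moreover have "\<not> p dvd \<epsilon>"
      using 3 \<open>\<epsilon> dvd T\<close> dvd_trans by blast
    ultimately have "\<epsilon> dvd R"
      using cancel by blast
    then show ?thesis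
      by (simp add: e)
  qed
qed

lemma prime_elem_not_dvd_prod:
  fixes p :: "'a::idom"
  assumes "prime_elem p" "\<And>i. i \<in> S \<Longrightarrow> \<not> p dvd f i"
  shows "\<not> p dvd prod f S"
  using assms(2)
proof (induction S rule: infinite_finite_induct)
  case (insert i S)
  then show ?case
    using prime_elem_dvd_multD[OF assms(1)] by auto
qed (use assms(1) in \<open>auto simp: prime_elem_def\<close>)

text \<open>The exponents are lowered from 3 to 1 one prime at a time, with \<open>J\<close> the set
  of primes already treated.\<close>

lemma dvd_prod_primes:
  fixes f :: "'i \<Rightarrow> 'a::idom"
  assumes "finite I"
    and prime: "\<And>i. i \<in> I \<Longrightarrow> prime_elem (f i)"
    and distinct: "\<And>i j. i \<in> I \<Longrightarrow> j \<in> I \<Longrightarrow> f i dvd f j \<Longrightarrow> i = j"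
    and cube: "\<delta> dvd (\<Prod>i\<in>I. f i) ^ 3"
    and dvd: "\<And>i. i \<in> I \<Longrightarrow> \<delta> dvd f i * (\<Prod>j\<in>I - {i}. f j) ^ 3"
  shows "\<delta> dvd (\<Prod>i\<in>I. f i)"
proof -
  have "\<delta> dvd (\<Prod>i\<in>J. f i) * (\<Prod>i\<in>I - J. f i) ^ 3" if "J \<subseteq> I" for J
    using finite_subset[OF that \<open>finite I\<close>] that
  proof (induction J)
    case empty
    then show ?case using cube by simp
  next
    case (insert i J)
    have i: "i \<in> I" "i \<in> I - J"
      using insert by auto
    have "(\<Prod>i\<in>I - J. f i) = f i * (\<Prod>i\<in>I - insert i J. f i)"
      using prod.remove[of "I - J" i f] i(2) \<open>finite I\<close> by (simp flip: Diff_insert)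
    moreover have "\<delta> dvd (\<Prod>i\<in>J. f i) * (\<Prod>i\<in>I - J. f i) ^ 3"
      using insert.IH insert.prems by blast
    ultimately have 1: "\<delta> dvd f i ^ 3 * ((\<Prod>i\<in>J. f i) * (\<Prod>i\<in>I - insert i J. f i) ^ 3)"
      by (simp only: power_mult_distrib mult.left_commute)
    have "\<not> f i dvd (\<Prod>j\<in>I - {i}. f j) ^ 3"
      using prime_elem_not_dvd_prod[OF prime[OF i(1)], of "I - {i}" f] distinct[OF i(1)]
        prime_elem_dvd_power[OF prime[OF i(1)]] by blast
    from dvd_reduce_prime_power[OF prime[OF i(1)] 1 dvd[OF i(1)] this]
    show ?case
      by (simp only: prod.insert[OF insert.hyps] mult.assoc)
  qed
  from this[of I] show ?thesis by simp
qed

section \<open>Homogeneous components in an affine chart\<close>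

definition coeff_vec :: "'r::zero poly ^ 'n \<Rightarrow> nat \<Rightarrow> 'r ^ 'n" where
  "coeff_vec u d = (\<chi> i. coeff (u $ i) d)"

text \<open>A coefficient of the determinant is a sum of determinants of coefficient vectors. A
  nonzero summand selects one homogeneous component of each row such that the three stay
  independent.\<close>

lemma coeff_trip:
  fixes u v w :: "'r::comm_ring_1 poly ^ 3"
  assumes "coeff (trip u v w) j \<noteq> 0"
  obtains d1 d2 d3 where "d1 + d2 + d3 = j" "trip (coeff_vec u d1) (coeff_vec v d2) (coeff_vec w d3) \<noteq> 0"
proof -
  have "coeff (trip u v w) j =
      (\<Sum>d1\<le>j. \<Sum>d2\<le>j - d1. trip (coeff_vec u d1) (coeff_vec v d2) (coeff_vec w (j - d1 - d2)))"
    by (simp add: trip_def dot_def cross_def coeff_mult coeff_vec_def sum_distrib_left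
        sum.distrib sum_subtractf right_diff_distrib distrib_left mult.assoc)
  with assms obtain d1 d2 where "d1 \<le> j" "d2 \<le> j - d1"
    "trip (coeff_vec u d1) (coeff_vec v d2) (coeff_vec w (j - d1 - d2)) \<noteq> 0"
    by (auto elim!: sum.not_neutral_contains_not_neutral)
  then show thesis
    by (intro that[of d1 d2 "j - d1 - d2"]) auto
qed

lemma low_coeff_nonzero:
  fixes p q :: "'a::comm_ring_1 poly"
  assumes "coeff (p * q) n \<noteq> 0"
  obtains j where "j \<le> n" "coeff p j \<noteq> 0"
proof -
  obtain j where "j \<le> n" "coeff p j * coeff q (n - j) \<noteq> 0"
    using assms unfolding coeff_mult by (auto elim: sum.not_neutral_contains_not_neutral)
  then show thesis
    by (intro that[of j]) auto
qed

text \<open>In \<open>'k pol3\<close> as the target of the substitution, the variables are \<open>z\<close>, \<open>y\<close>, \<open>s\<close> from the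
  inside out; the substitution evaluates a polynomial at the point \<open>s (u + y w + z e)\<close>. The
  coefficient of \<open>s ^ d\<close> is thus the dehomogenisation of the component of degree \<open>d\<close>.\<close>

definition chart_coord :: "'k::field ^ 3 \<Rightarrow> 'k ^ 3 \<Rightarrow> 'k ^ 3 \<Rightarrow> 3 \<Rightarrow> 'k pol3" where
  "chart_coord u w e i = [:0, [:[:u $ i, e $ i:], [:w $ i:]:]:]"

definition chart :: "'k::field ^ 3 \<Rightarrow> 'k ^ 3 \<Rightarrow> 'k ^ 3 \<Rightarrow> 'k pol3 \<Rightarrow> 'k pol3" where
  "chart u w e f =
     poly (map_poly (\<lambda>g. poly (map_poly (\<lambda>h. poly (map_poly Const3 h) (chart_coord u w e 1)) g)
       (chart_coord u w e 2)) f) (chart_coord u w e 3)"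

lemma comm_ring_hom_Const3: "comm_ring_hom Const3"
  by unfold_locales (simp_all add: Const3_def one_pCons)

lemma comm_ring_hom_chart: "comm_ring_hom (chart u w e)"
  unfolding chart_def
  by (intro comm_ring_hom.poly_map_poly_hom comm_ring_hom_Const3)

lemma chart_Const3: "chart u w e (Const3 c) = Const3 c"
  by (simp add: chart_def Const3_def map_poly_pCons)

lemma chart_linear_form:
  "chart u w e (linear_form a) = [:0, [:[:dot a u, dot a e:], [:dot a w:]:]:]"
  by (simp add: linear_form_conv chart_def chart_coord_def Const3_def map_poly_pCons dot_def
      algebra_simps)

text \<open>The total degree in \<open>y\<close> and \<open>z\<close> is at most the degree in
  \<open>s\<close>. This is the degree bound for a dehomogenised component of degree
  \<open>d\<close>, stated for all components at once.\<close>

definition weighted :: "'k::field pol3 \<Rightarrow> bool" where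
  "weighted F \<longleftrightarrow> (\<forall>d j i. d < i + j \<longrightarrow> coeff (coeff (coeff F d) j) i = 0)"

lemma weighted_add: "weighted F \<Longrightarrow> weighted G \<Longrightarrow> weighted (F + G)"
  by (simp add: weighted_def)

lemma weighted_mult:
  assumes "weighted F" "weighted G"
  shows "weighted (F * G)"
  unfolding weighted_def
proof (intro allI impI)
  fix d j i :: nat
  assume less: "d < i + j"
  have "coeff (coeff (coeff F d') j') i' * coeff (coeff (coeff G (d - d')) (j - j')) (i - i') = 0"
    if "d' \<le> d" "j' \<le> j" "i' \<le> i" for d' j' i'
  proof (cases "d' < i' + j'")
    case False
    then have "d - d' < (i - i') + (j - j')"
      using less that by linarith
    then show ?thesis
      using assms(2) by (simp add: weighted_def)
  qed (use assms(1) in \<open>simp add: weighted_def\<close>)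
  then show "coeff (coeff (coeff (F * G) d) j) i = 0"
    by (auto simp: coeff_mult coeff_sum intro!: sum.neutral)
qed

lemma weighted_Const3: "weighted (Const3 c)"
  by (auto simp: weighted_def Const3_def coeff_pCons split: nat.splits)

lemma weighted_chart_coord: "weighted (chart_coord u w e i)"
  by (auto simp: weighted_def chart_coord_def coeff_pCons split: nat.splits)

lemma weighted_poly_map_poly:
  assumes "\<And>c. weighted (\<phi> c)" "weighted x"
  shows "weighted (poly (map_poly \<phi> p) x)"
proof -
  have "weighted 0"
    by (simp add: weighted_def)
  have "weighted (poly q x)" if "\<And>n. weighted (coeff q n)" for q
    using that
  proof (induction q)
    case (pCons c q)
    have "weighted c" "\<And>n. weighted (coeff q n)"
      using pCons.prems[of 0] pCons.prems[of "Suc n" for n] by simp_all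
    then show ?case
      using pCons.IH assms(2) by (simp add: weighted_add weighted_mult)
  qed (use \<open>weighted 0\<close> in simp)
  \<comment> \<open>It is not assumed that \<open>\<phi> 0 = 0\<close>, so the coefficients beyond
    \<open>degree p\<close>, which are 0, form a separate case.\<close>
  moreover have "weighted (coeff (map_poly \<phi> p) n)" for n
    using assms(1) \<open>weighted 0\<close> by (cases "n \<le> degree p")
      (auto simp: map_poly_def coeff_Poly_eq nth_default_def)
  ultimately show ?thesis by blast
qed

lemma weighted_chart: "weighted (chart u w e f)"
  unfolding chart_def by (intro weighted_poly_map_poly weighted_Const3 weighted_chart_coord)

lemma (in comm_ring_hom) trip:
  "\<phi> (trip x y z) = trip (\<chi> i. \<phi> (x $ i)) (\<chi> i. \<phi> (y $ i)) (\<chi> i. \<phi> (z $ i))"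
  by (simp add: vec3_simps add mult diff)

section \<open>Logarithmic modules and the divisibility in Saito's criterion\<close>

definition const_vec :: "'k::field ^ 3 \<Rightarrow> 'k pol3 ^ 3" where
  "const_vec a = (\<chi> i. Const3 (a $ i))"

lemma dot_const_vec: "dot (const_vec a) (const_vec b) = Const3 (dot a b)"
proof -
  interpret c: comm_ring_hom Const3 by (rule comm_ring_hom_Const3)
  show ?thesis by (simp add: dot_def const_vec_def c.add c.mult)
qed

lemma trip_const_vec: "trip (const_vec a) (const_vec b) (const_vec c) = Const3 (trip a b c)"
  unfolding const_vec_def by (rule comm_ring_hom.trip[OF comm_ring_hom_Const3, symmetric])

lemma dot_scale: "dot a (k *s b) = k * dot a b"
  by (simp add: dot_def algebra_simps)

lemma der_apply_linear_form_dot: "der_apply \<theta> (linear_form a) = dot (const_vec a) \<theta>"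
  by (simp add: der_apply_linear_form dot_def const_vec_def mult.commute)

text \<open>The logarithmic derivations in terms of one chosen form per line;
  \<open>log_der_eq_log_module\<close> makes the connection with \<open>log_der\<close>.\<close>

definition log_module :: "('k::field ^ 3) set \<Rightarrow> ('k pol3 ^ 3) set" where
  "log_module F = {\<theta>. \<forall>a\<in>F. linear_form a dvd dot (const_vec a) \<theta>}"

text \<open>With \<open>Q\<close> the product of the forms, \<open>Q\<close> times the constant
  fields gives the divisibility of \<open>Q ^ 3\<close>. For each form \<open>a\<close>, two
  constant fields tangent to its line, times \<open>Q\<close> without \<open>a\<close>, and a
  transverse one times \<open>Q\<close> lower the exponent of \<open>a\<close> to 1.\<close>

lemma free_log_module_trip_dvd:
  fixes F :: "('k::field ^ 3) set"
  assumes "finite F" "0 \<notin> F" and free: "free_submodule (log_module F)"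
    and distinct: "\<And>a b. a \<in> F \<Longrightarrow> b \<in> F \<Longrightarrow> linear_form a dvd linear_form b \<Longrightarrow> a = b"
  obtains \<theta>1 \<theta>2 \<theta>3 where "\<theta>1 \<in> log_module F" "\<theta>2 \<in> log_module F" "\<theta>3 \<in> log_module F"
    "trip \<theta>1 \<theta>2 \<theta>3 dvd (\<Prod>a\<in>F. linear_form a)"
proof -
  define Q where "Q = (\<lambda>S::('k ^ 3) set. \<Prod>a\<in>S. linear_form a)"
  have one: "Const3 1 = 1"
    using comm_ring_hom_Const3 by (rule comm_ring_hom.one)
  have zero: "Const3 0 = 0"
    using comm_ring_hom_Const3 by (rule comm_ring_hom.zero)
  have prime: "prime_elem (linear_form a)" if "a \<in> F" for a
    using that \<open>0 \<notin> F\<close> by (intro prime_elem_linear_form) auto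
  have dvd_Q: "linear_form a dvd Q S" if "a \<in> S" "S \<subseteq> F" for a S
    unfolding Q_def using that \<open>finite F\<close> finite_subset by (intro dvd_prodI) auto
  have "Q F \<noteq> 0"
    using prime prime_elem_not_zeroI \<open>finite F\<close> by (fastforce simp: Q_def)
  obtain p q where pq: "cross p q = (vector [1, 0, 0] :: 'k ^ 3)"
    by (rule cross_surj[of "vector [1, 0, 0] :: 'k ^ 3"]) (auto simp: vec_eq_iff forall_3)
  define r where "r = (vector [1, 0, 0] :: 'k ^ 3)"
  have pqr: "trip r p q = 1"
    by (simp add: trip_def pq r_def dot_def)
  have mem: "Q F *s const_vec v \<in> log_module F" for v
    by (simp add: log_module_def dot_scale dvd_Q)
  have trip_QF: "trip (Q F *s const_vec r) (Q F *s const_vec p) (Q F *s const_vec q) = Q F ^ 3"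
    by (simp add: trip_scale trip_const_vec pqr one power3_eq_cube)
  obtain \<theta>1 \<theta>2 \<theta>3 where th: "\<theta>1 \<in> log_module F" "\<theta>2 \<in> log_module F" "\<theta>3 \<in> log_module F"
    and dvd: "\<And>x y z. x \<in> log_module F \<Longrightarrow> y \<in> log_module F \<Longrightarrow> z \<in> log_module F \<Longrightarrow>
      trip \<theta>1 \<theta>2 \<theta>3 dvd trip x y z"
    using free_submodule_trip[OF free mem mem mem, of r p q] trip_QF \<open>Q F \<noteq> 0\<close> by auto
  have "trip \<theta>1 \<theta>2 \<theta>3 dvd Q F"
    unfolding Q_def
  proof (rule dvd_prod_primes[OF \<open>finite F\<close> prime distinct])
    show "trip \<theta>1 \<theta>2 \<theta>3 dvd (\<Prod>a\<in>F. linear_form a) ^ 3"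
      using dvd[OF mem mem mem, of r p q] trip_QF by (simp add: Q_def)
  next
    fix a assume a: "a \<in> F"
    then have "a \<noteq> 0"
      using \<open>0 \<notin> F\<close> by auto
    then obtain v where v: "dot a v = 1"
      by (rule dot_surj)
    then have "v \<noteq> 0"
      by (auto simp: dot_def)
    then obtain p q where pq: "cross p q = v"
      by (rule cross_surj)
    \<comment> \<open>The form \<open>a\<close> vanishes on \<open>cross a x\<close>, so that the
      constant field in this direction is tangent to its line and the factor \<open>a\<close> can be
      omitted.\<close>
    have 1: "Q (F - {a}) *s const_vec (cross a x) \<in> log_module F" for x
    proof -
      have "linear_form b dvd Q (F - {a}) * Const3 (dot b (cross a x))" if "b \<in> F" for b
        using that dvd_Q[of b "F - {a}"] by (cases "b = a") (auto simp: dot_cross_self zero)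
      then show ?thesis
        by (simp add: log_module_def dot_scale dot_const_vec)
    qed
    have 2: "(Q (F - {a}) * linear_form a) *s const_vec v \<in> log_module F"
    proof -
      have "linear_form b dvd Q (F - {a}) * linear_form a" if "b \<in> F" for b
        using that dvd_Q[of b "F - {a}"] by (cases "b = a") auto
      then show ?thesis
        by (simp add: log_module_def dot_scale)
    qed
    have "trip (cross a p) (cross a q) v = 1"
      by (simp add: trip_cross_left pq v)
    then have "trip (Q (F - {a}) *s const_vec (cross a p)) (Q (F - {a}) *s const_vec (cross a q))
        ((Q (F - {a}) * linear_form a) *s const_vec v) = linear_form a * Q (F - {a}) ^ 3"
      by (simp add: trip_scale trip_const_vec one power3_eq_cube algebra_simps)
    with dvd[OF 1 1 2, of p q]
    show "trip \<theta>1 \<theta>2 \<theta>3 dvd linear_form a * (\<Prod>b\<in>F - {a}. linear_form b) ^ 3"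
      by (simp add: Q_def)
  qed auto
  with th show thesis
    using that by (simp add: Q_def)
qed

section \<open>Coordinates adapted to \<open>H\<close>\<close>

lemma dot_eq_imp_eq: "(\<And>x. dot a x = dot b x) \<Longrightarrow> a = b"
proof -
  assume eq: "\<And>x. dot a x = dot b x"
  show "a = b"
    using eq[of "vector [1, 0, 0]"] eq[of "vector [0, 1, 0]"] eq[of "vector [0, 0, 1]"]
    by (simp add: vec_eq_iff forall_3 dot_def)
qed

text \<open>The coordinates dual to \<open>u\<close>, \<open>w\<close>, \<open>e\<close> serve as
  \<open>x\<close>, \<open>y\<close>, \<open>z\<close>, and \<open>H\<close> will be the span of
  \<open>u\<close> and \<open>w\<close>. Since \<open>w\<close> lies on none of the other lines,
  their forms can be scaled to \<open>y - t x - c z\<close>; \<open>chart_point\<close> reads off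
  \<open>(t, c)\<close>.\<close>

locale frame =
  fixes u w e :: "'k::field_char_0 ^ 3" and F :: "('k ^ 3) set"
  assumes trip_frame: "trip u w e = 1"
    and finite_F: "finite F"
    and normalised: "\<And>a. a \<in> F \<Longrightarrow> dot a w = 1"
begin

definition chart_point :: "'k ^ 3 \<Rightarrow> 'k \<times> 'k" where
  "chart_point a = (- dot a u, - dot a e)"

lemma form_expansion:
  "dot a x = dot a u * dot (cross w e) x + dot a w * dot (cross e u) x + dot a e * dot (cross u w) x"
  using dual_frame_expansion[of u w e a x] by (simp add: trip_frame)

lemma inj_chart_point: "inj_on chart_point F"
proof (rule inj_onI)
  fix a b assume ab: "a \<in> F" "b \<in> F" "chart_point a = chart_point b"
  show "a = b"
  proof (rule dot_eq_imp_eq)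
    fix x
    show "dot a x = dot b x"
      using form_expansion[of a x] form_expansion[of b x] ab by (simp add: normalised chart_point_def)
  qed
qed

text \<open>The chart maps the form to \<open>s (y - t - c z)\<close>. The factor
  \<open>y - t - c z\<close> is constant in \<open>s\<close> and hence divides each coefficient:
  homogeneous components inherit the divisibility.\<close>

lemma chart_point_dvd_coeff:
  assumes "a \<in> F" "linear_form a dvd f"
  shows "[:- [:fst (chart_point a), snd (chart_point a):], 1:] dvd coeff (chart u w e f) d"
proof -
  have "[:0, [:- [:fst (chart_point a), snd (chart_point a):], 1:]:] dvd chart u w e f"
    using comm_ring_hom.dvd[OF comm_ring_hom_chart assms(2), of u w e]
    by (simp add: chart_linear_form chart_point_def normalised[OF assms(1)] one_pCons)
  moreover have "[:[:- [:fst (chart_point a), snd (chart_point a):], 1:]:] dvd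
      [:0, [:- [:fst (chart_point a), snd (chart_point a):], 1:]:]"
    by (simp add: const_poly_dvd_iff coeff_pCons split: nat.splits)
  ultimately have "[:[:- [:fst (chart_point a), snd (chart_point a):], 1:]:] dvd chart u w e f"
    using dvd_trans by blast
  then show ?thesis
    by (simp only: const_poly_dvd_iff)
qed

lemma linear_form_dvd_imp_eq:
  assumes "a \<in> F" "b \<in> F" "linear_form a dvd linear_form b"
  shows "a = b"
proof -
  have "[:- [:fst (chart_point a), snd (chart_point a):], 1:] dvd
      [:- [:fst (chart_point b), snd (chart_point b):], 1:]"
    using chart_point_dvd_coeff[OF assms(1,3), of 1]
    by (simp add: chart_linear_form chart_point_def normalised[OF assms(2)] one_pCons)
  then have "poly [:- [:fst (chart_point b), snd (chart_point b):], 1:]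
      [:fst (chart_point a), snd (chart_point a):] = 0"
    by (simp only: poly_eq_0_iff_dvd)
  then have "chart_point a = chart_point b"
    by (simp add: prod_eq_iff)
  then show ?thesis
    using inj_chart_point assms(1,2) by (simp add: inj_on_def)
qed

text \<open>The coefficients of the derivation in the dual coordinates; \<open>chart_C\<close> is
  the component normal to \<open>H\<close>.\<close>

definition chart_A :: "'k pol3 ^ 3 \<Rightarrow> 'k pol3" where
  "chart_A \<theta> = chart u w e (dot (const_vec (cross w e)) \<theta>)"
definition chart_B :: "'k pol3 ^ 3 \<Rightarrow> 'k pol3" where
  "chart_B \<theta> = chart u w e (dot (const_vec (cross e u)) \<theta>)"
definition chart_C :: "'k pol3 ^ 3 \<Rightarrow> 'k pol3" where
  "chart_C \<theta> = chart u w e (dot (const_vec (cross u w)) \<theta>)"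

lemma restricted_derivation_log:
  assumes "\<theta> \<in> log_module F"
  shows "restricted_derivation (chart_point ` F) (coeff (chart_A \<theta>) d) (coeff (chart_B \<theta>) d)
    (coeff (chart_C \<theta>) d)"
proof
  show "finite (chart_point ` F)"
    using finite_F by simp
next
  interpret h: comm_ring_hom "chart u w e" by (rule comm_ring_hom_chart)
  interpret c: comm_ring_hom Const3 by (rule comm_ring_hom_Const3)
  fix t c assume "(t, c) \<in> chart_point ` F"
  then obtain a where a: "a \<in> F" "t = - dot a u" "c = - dot a e"
    by (auto simp: chart_point_def)
  have "const_vec a = Const3 (dot a u) *s const_vec (cross w e) + const_vec (cross e u)
      + Const3 (dot a e) *s const_vec (cross u w)"
  proof -
    have "a = dot a u *s cross w e + cross e u + dot a e *s cross u w"
    proof (rule dot_eq_imp_eq)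
      fix x
      have lin: "dot (k *s p + q + l *s r) x = k * dot p x + dot q x + l * dot r x"
        for k l :: 'k and p q r
        by (simp add: dot_def algebra_simps)
      show "dot a x = dot (dot a u *s cross w e + cross e u + dot a e *s cross u w) x"
        unfolding lin using form_expansion[of a x] normalised[OF a(1)] by simp
    qed
    from arg_cong[OF this, of "\<lambda>v. \<lambda>i. Const3 (v $ i)"] show ?thesis
      by (simp add: vec_eq_iff const_vec_def fun_eq_iff c.add c.mult)
  qed
  then have "dot (const_vec a) \<theta> = Const3 (dot a u) * dot (const_vec (cross w e)) \<theta>
      + dot (const_vec (cross e u)) \<theta> + Const3 (dot a e) * dot (const_vec (cross u w)) \<theta>"
    by (simp add: dot_def algebra_simps)
  then have chart_dot: "chart u w e (dot (const_vec a) \<theta>) =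
      Const3 (dot a u) * chart_A \<theta> + chart_B \<theta> + Const3 (dot a e) * chart_C \<theta>"
    by (simp add: h.add h.mult chart_Const3 chart_A_def chart_B_def chart_C_def)
  have "[:- [:t, c:], 1:] dvd coeff (chart u w e (dot (const_vec a) \<theta>)) d"
    using chart_point_dvd_coeff[OF a(1), of "dot (const_vec a) \<theta>" d] assms a
    by (simp add: log_module_def chart_point_def)
  then have "poly (coeff (chart u w e (dot (const_vec a) \<theta>)) d) [:t, c:] = 0"
    by (simp only: poly_eq_0_iff_dvd)
  then show "poly (coeff (chart_B \<theta>) d - smult [:t:] (coeff (chart_A \<theta>) d)
      - smult [:c:] (coeff (chart_C \<theta>) d)) [:t, c:] = 0"
    by (simp add: chart_dot Const3_def a add_ac)
qed

text \<open>Sets \<open>z = 0\<close>; after the substitution \<open>z\<close> is the innermost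
  variable.\<close>

definition restriction :: "'k pol3 \<Rightarrow> 'k poly poly" where
  "restriction f = map_poly (map_poly (\<lambda>p. coeff p 0)) f"

lemma comm_ring_hom_restriction: "comm_ring_hom restriction"
  unfolding restriction_def
  by (intro comm_ring_hom.map_poly_hom comm_ring_hom_coeff_0)

lemma coeff_restriction: "coeff (restriction f) d = map_poly (\<lambda>p. coeff p 0) (coeff f d)"
  by (simp add: restriction_def coeff_map_poly)

definition restricted_vec :: "'k pol3 ^ 3 \<Rightarrow> 'k poly poly ^ 3" where
  "restricted_vec \<theta> =
     vector [restriction (chart_A \<theta>), restriction (chart_B \<theta>), restriction (chart_C \<theta>)]"

text \<open>The change to the dual coordinates has determinant \<open>trip u w e ^ 2 = 1\<close>,
  and ring homomorphisms commute with determinants.\<close>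

lemma trip_restricted_vec:
  "trip (restricted_vec x) (restricted_vec y) (restricted_vec z) =
     restriction (chart u w e (trip x y z))"
proof -
  interpret h: comm_ring_hom "\<lambda>f. restriction (chart u w e f)"
    by (rule comm_ring_hom_comp[OF comm_ring_hom_restriction comm_ring_hom_chart])
  let ?v = "\<lambda>x. vector [dot (const_vec (cross w e)) x, dot (const_vec (cross e u)) x,
    dot (const_vec (cross u w)) x]"
  have "restricted_vec x = (\<chi> i. restriction (chart u w e (?v x $ i)))" for x
    by (simp add: vec_eq_iff forall_3 restricted_vec_def chart_A_def chart_B_def chart_C_def)
  then have "trip (restricted_vec x) (restricted_vec y) (restricted_vec z) =
      restriction (chart u w e (trip (?v x) (?v y) (?v z)))"
    by (simp only: h.trip)
  also have "trip (?v x) (?v y) (?v z) = trip x y z"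
    by (simp add: trip_dot trip_const_vec trip_cross trip_frame
        comm_ring_hom.one[OF comm_ring_hom_Const3])
  finally show ?thesis .
qed

text \<open>The three cases are a nonzero normal component, a tangential row of large degree, and a
  multiple of the restricted Euler derivation \<open>(1, y, 0)\<close>, which is zero in degree
  0.\<close>

lemma restricted_row:
  fixes d :: nat and \<theta> :: "'k pol3 ^ 3"
  defines "x \<equiv> coeff_vec (restricted_vec \<theta>) d" and "h \<equiv> card (fst ` chart_point ` F)"
  assumes "\<theta> \<in> log_module F" "h \<ge> 2"
    and mult: "\<And>t. t \<in> fst ` chart_point ` F \<Longrightarrow> card (fibre (chart_point ` F) t) \<ge> 2"
  shows "card F \<le> d + h \<or> x $ 3 = 0 \<and> h \<le> d \<or>
    x $ 3 = 0 \<and> x $ 2 = [:0, 1:] * x $ 1 \<and> (d = 0 \<longrightarrow> x $ 1 = 0)"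
proof -
  interpret R: restricted_derivation "chart_point ` F" "coeff (chart_A \<theta>) d"
    "coeff (chart_B \<theta>) d" "coeff (chart_C \<theta>) d"
    by (rule restricted_derivation_log) fact
  have x: "x $ 1 = R.r0 (coeff (chart_A \<theta>) d)" "x $ 2 = R.r0 (coeff (chart_B \<theta>) d)"
    "x $ 3 = R.r0 (coeff (chart_C \<theta>) d)"
    by (simp_all add: x_def coeff_vec_def restricted_vec_def coeff_restriction)
  have deg: "degree (R.r0 (coeff (chart u w e f) d)) \<le> d" for f
    using weighted_chart[of u w e f] by (intro degree_le) (simp add: coeff_map_poly weighted_def)
  have card: "card (chart_point ` F) = card F"
    using inj_chart_point by (rule card_image)
  show ?thesis
  proof (cases "x $ 3 = 0")
    case False
    then show ?thesis
      using R.degree_normal_ge deg[of "dot (const_vec (cross u w)) \<theta>"]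
      by (simp add: x card h_def chart_C_def)
  next
    case True
    show ?thesis
    proof (cases "h \<le> d")
      case False
      have "coeff (coeff (coeff (chart_C \<theta>) d) j) 1 = 0" if "d \<le> j" for j
        using weighted_chart[of u w e "dot (const_vec (cross u w)) \<theta>"] that
        by (simp add: chart_C_def weighted_def)
      moreover have "R.r0 (coeff (chart_C \<theta>) d) = 0"
        using True by (simp add: x)
      moreover have "degree (R.r0 (coeff (chart_A \<theta>) d)) \<le> d"
        "degree (R.r0 (coeff (chart_B \<theta>) d)) \<le> d"
        unfolding chart_A_def chart_B_def by (rule deg)+
      moreover have "d < card (fst ` chart_point ` F)" "2 \<le> card (fst ` chart_point ` F)"
        using False \<open>h \<ge> 2\<close> by (simp_all add: h_def)
      ultimately obtain p where "R.r0 (coeff (chart_A \<theta>) d) = p"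
        "R.r0 (coeff (chart_B \<theta>) d) = [:0, 1:] * p" "d = 0 \<Longrightarrow> p = 0"
        using R.euler_multiple[OF _ _ _ mult] by blast
      then show ?thesis
        using True x by simp
    qed (use True in simp)
  qed
qed

text \<open>One row contributes at least \<open>n - h\<close>. Of the other two, at most one is an
  Euler multiple, contributing at least 1, and the rest contribute at least \<open>h\<close>
  each.\<close>

lemma degree_count:
  fixes n h d1 d2 d3 :: nat
  assumes normal: "n \<le> d1 + h \<or> n \<le> d2 + h \<or> n \<le> d3 + h"
    and "h \<le> d1 \<or> E1" "h \<le> d2 \<or> E2" "h \<le> d3 \<or> E3"
    and "\<not> (E1 \<and> E2)" "\<not> (E1 \<and> E3)" "\<not> (E2 \<and> E3)"
    and "E1 \<Longrightarrow> d1 \<noteq> 0" "E2 \<Longrightarrow> d2 \<noteq> 0" "E3 \<Longrightarrow> d3 \<noteq> 0"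
    and "2 * h \<le> n" "0 < h" "d1 + d2 + d3 \<le> n"
  shows False
  using normal
  by (elim disjE) (use assms(2-) in \<open>cases E1; cases E2; cases E3; simp\<close>)+

lemma not_free_if_multiplicities_ge_2:
  assumes h: "card (fst ` chart_point ` F) \<ge> 2"
    and mult: "\<And>t. t \<in> fst ` chart_point ` F \<Longrightarrow> card (fibre (chart_point ` F) t) \<ge> 2"
  shows "\<not> free_submodule (log_module F)"
proof
  assume free: "free_submodule (log_module F)"
  define h where "h = card (fst ` chart_point ` F)"
  have "0 \<notin> F"
    using normalised[of 0] by (auto simp: dot_def)
  obtain \<theta>1 \<theta>2 \<theta>3 where th: "\<theta>1 \<in> log_module F" "\<theta>2 \<in> log_module F" "\<theta>3 \<in> log_module F"
    and dvd: "trip \<theta>1 \<theta>2 \<theta>3 dvd (\<Prod>a\<in>F. linear_form a)"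
    by (rule free_log_module_trip_dvd[OF finite_F \<open>0 \<notin> F\<close> free linear_form_dvd_imp_eq])
  interpret h: comm_ring_hom "\<lambda>f. restriction (chart u w e f)"
    by (rule comm_ring_hom_comp[OF comm_ring_hom_restriction comm_ring_hom_chart])
  \<comment> \<open>Every form restricts to \<open>s\<close> times a nonzero polynomial in
    \<open>y\<close>, so their product lives in the single degree \<open>card F\<close> in
    \<open>s\<close>.\<close>
  have "restriction (chart u w e (linear_form a)) = monom [:dot a u, 1:] 1" if "a \<in> F" for a
    by (simp add: chart_linear_form normalised[OF that] restriction_def map_poly_pCons monom_altdef)
  then have "restriction (chart u w e (\<Prod>a\<in>F. linear_form a)) = (\<Prod>a\<in>F. monom [:dot a u, 1:] 1)"
    by (simp add: h.prod)
  also have "\<dots> = monom (\<Prod>a\<in>F. [:dot a u, 1:]) (card F)"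
    using finite_F by (induction F) (simp_all add: mult_monom)
  finally have "coeff (restriction (chart u w e (\<Prod>a\<in>F. linear_form a))) (card F) \<noteq> 0"
    using finite_F by simp
  moreover obtain g where "restriction (chart u w e (\<Prod>a\<in>F. linear_form a)) =
      trip (restricted_vec \<theta>1) (restricted_vec \<theta>2) (restricted_vec \<theta>3) * g"
    using h.dvd[OF dvd] by (auto simp: trip_restricted_vec)
  ultimately obtain j where "j \<le> card F"
    "coeff (trip (restricted_vec \<theta>1) (restricted_vec \<theta>2) (restricted_vec \<theta>3)) j \<noteq> 0"
    by (auto elim: low_coeff_nonzero)
  then obtain d1 d2 d3 where d: "d1 + d2 + d3 \<le> card F"
    and nz: "trip (coeff_vec (restricted_vec \<theta>1) d1) (coeff_vec (restricted_vec \<theta>2) d2)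
      (coeff_vec (restricted_vec \<theta>3) d3) \<noteq> 0"
    by (auto elim: coeff_trip)
  define x y z where xyz: "x = coeff_vec (restricted_vec \<theta>1) d1"
    "y = coeff_vec (restricted_vec \<theta>2) d2" "z = coeff_vec (restricted_vec \<theta>3) d3"
  note row = restricted_row[OF _ h mult, folded h_def]
  have "2 * h = (\<Sum>t\<in>fst ` chart_point ` F. 2)"
    by (simp add: h_def)
  also have "\<dots> \<le> (\<Sum>t\<in>fst ` chart_point ` F. card (fibre (chart_point ` F) t))"
    using mult by (rule sum_mono)
  also have "\<dots> = card F"
    using finite_F inj_chart_point by (simp add: sum_card_fibre card_image)
  finally have n: "2 * h \<le> card F" .
  have "2 \<le> h"
    using h by (simp add: h_def)
  have nz': "trip x y z \<noteq> 0"
    using nz by (simp add: xyz)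
  have normal: "\<not> (x $ 3 = 0 \<and> y $ 3 = 0 \<and> z $ 3 = 0)"
    using nz' by (auto simp: vec3_simps)
  define E where "E v k \<longleftrightarrow> v $ 3 = 0 \<and> v $ 2 = [:0, 1:] * v $ 1 \<and> (k = 0 \<longrightarrow> v $ 1 = 0)"
    for v :: "'k poly ^ 3" and k :: nat
  have rows: "card F \<le> d1 + h \<or> x $ 3 = 0 \<and> h \<le> d1 \<or> x $ 3 = 0 \<and> E x d1"
    "card F \<le> d2 + h \<or> y $ 3 = 0 \<and> h \<le> d2 \<or> y $ 3 = 0 \<and> E y d2"
    "card F \<le> d3 + h \<or> z $ 3 = 0 \<and> h \<le> d3 \<or> z $ 3 = 0 \<and> E z d3"
    using row[OF th(1), of d1] row[OF th(2), of d2] row[OF th(3), of d3]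
    unfolding E_def xyz by blast+
  show False
  proof (rule degree_count)
    show "card F \<le> d1 + h \<or> card F \<le> d2 + h \<or> card F \<le> d3 + h"
      using rows normal by blast
    \<comment> \<open>A degree of at least \<open>card F - h\<close> is also at least
      \<open>h\<close>, because \<open>2 * h \<le> card F\<close>.\<close>
    show "h \<le> d1 \<or> E x d1" "h \<le> d2 \<or> E y d2" "h \<le> d3 \<or> E z d3"
      using rows n by linarith+
    \<comment> \<open>Two multiples of \<open>(1, y, 0)\<close> are proportional, and one of degree
      zero is the zero row; either would make the determinant vanish.\<close>
    show "\<not> (E x d1 \<and> E y d2)" "\<not> (E x d1 \<and> E z d3)" "\<not> (E y d2 \<and> E z d3)"
      using nz' by (auto simp: E_def vec3_simps)
    show "E x d1 \<Longrightarrow> d1 \<noteq> 0" "E y d2 \<Longrightarrow> d2 \<noteq> 0" "E z d3 \<Longrightarrow> d3 \<noteq> 0"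
      using nz' by (auto simp: E_def vec3_simps)
  qed (use n d \<open>2 \<le> h\<close> in auto)
qed

end

section \<open>Lines and points\<close>

lemma zero_set_conv: "zero_set a = {v. dot a v = 0}"
  by (simp add: zero_set_def dot_def)

lemma dot_zero: "dot a 0 = 0"
  by (simp add: dot_def)

lemma dot_linear: "dot a (x + y) = dot a x + dot a y" "dot a (x - y) = dot a x - dot a y"
  "dot (k *s a) x = k * dot a x"
  by (simp_all add: dot_def algebra_simps)

lemma zero_set_eq_imp_scale:
  fixes b c :: "'k::field ^ 3"
  assumes "zero_set b = zero_set c" "dot c w = 1"
  shows "b = dot b w *s c"
proof (rule dot_eq_imp_eq)
  fix x
  \<comment> \<open>This is the projection of \<open>x\<close> along \<open>w\<close> onto the
    common zero set.\<close>
  have "x - dot c x *s w \<in> zero_set c"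
    using assms(2) by (simp add: zero_set_conv dot_linear dot_scale)
  then have "dot b x = dot c x * dot b w"
    unfolding assms(1)[symmetric] by (simp add: zero_set_conv dot_linear dot_scale)
  then show "dot b x = dot (dot b w *s c) x"
    by (simp add: dot_linear)
qed

lemma log_der_eq_log_module:
  fixes g :: "('k::field ^ 3) set \<Rightarrow> 'k ^ 3"
  assumes "\<And>L. L \<in> A \<Longrightarrow> L = zero_set (g L)" "\<And>L. L \<in> A \<Longrightarrow> dot (g L) w = 1"
  shows "log_der A = log_module (g ` A)"
proof -
  interpret c: comm_ring_hom "Const3 :: 'k \<Rightarrow> _" by (rule comm_ring_hom_Const3)
  have "linear_form b dvd dot (const_vec b) \<theta>"
    if "linear_form (g L) dvd dot (const_vec (g L)) \<theta>" "L \<in> A" "L = zero_set b" for \<theta> L b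
  proof -
    have b: "b = dot b w *s g L"
      using assms that(2,3) by (intro zero_set_eq_imp_scale) auto
    have "linear_form (k *s a) = Const3 k * linear_form a" for k :: 'k and a
      by (simp add: linear_form_def c.mult algebra_simps)
    moreover have "dot (const_vec (k *s a)) \<theta> = Const3 k * dot (const_vec a) \<theta>" for k :: 'k and a
      by (simp add: dot_def const_vec_def c.mult algebra_simps)
    ultimately show ?thesis
      using that(1) by (subst (1 2) b) (simp add: mult_dvd_mono)
  qed
  then have "log_module (g ` A) \<subseteq> log_der A"
    unfolding log_der_def log_module_def der_apply_linear_form_dot by blast
  moreover have "log_der A \<subseteq> log_module (g ` A)"
    unfolding log_der_def log_module_def der_apply_linear_form_dot using assms(1) by blast
  ultimately show ?thesis
    by (rule subset_antisym[rotated])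
qed

lemma proj_point_span:
  fixes v :: "'k::field ^ 3"
  assumes "v \<noteq> 0"
  shows "proj_point (vec.span {v})"
proof -
  have "vec.independent {v}"
    using assms by simp
  then have "vec.dim (vec.span {v}) = 1"
    by (simp add: vec.dim_eq_card_independent)
  then show ?thesis
    by (simp add: proj_point_def)
qed

lemma span_subset_line:
  assumes "proj_line L"
  shows "vec.span {v} \<subseteq> L \<longleftrightarrow> v \<in> L"
proof
  show "vec.span {v} \<subseteq> L \<Longrightarrow> v \<in> L"
    using vec.span_base[of v "{v}"] by auto
  show "v \<in> L \<Longrightarrow> vec.span {v} \<subseteq> L"
    using assms by (intro vec.span_minimal) (auto simp: proj_line_def)
qed

text \<open>Each line excludes at most one value of \<open>k\<close>, and a field of characteristic
  zero is infinite.\<close>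

lemma exists_point_off_lines:
  fixes f :: "('k::field_char_0 ^ 3) set \<Rightarrow> 'k ^ 3"
  assumes "finite A" "\<And>L. L \<in> A \<Longrightarrow> dot (f L) p \<noteq> 0 \<or> dot (f L) q \<noteq> 0"
  shows "\<exists>k. \<forall>L\<in>A. dot (f L) (p + k *s q) \<noteq> 0"
proof -
  have "finite {k. dot (f L) (p + k *s q) = 0}" if "L \<in> A" for L
  proof (rule finite_subset)
    show "{k. dot (f L) (p + k *s q) = 0} \<subseteq> {- dot (f L) p / dot (f L) q}"
    proof
      fix k assume "k \<in> {k. dot (f L) (p + k *s q) = 0}"
      then have k: "dot (f L) p = - (k * dot (f L) q)"
        by (simp add: dot_linear dot_scale eq_neg_iff_add_eq_0)
      then have "dot (f L) q \<noteq> 0"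
        using assms(2)[OF that] by auto
      then show "k \<in> {- dot (f L) p / dot (f L) q}"
        by (simp add: k)
    qed
  qed simp
  then have "finite (\<Union>L\<in>A. {k. dot (f L) (p + k *s q) = 0})"
    using assms(1) by blast
  then obtain k where "k \<notin> (\<Union>L\<in>A. {k. dot (f L) (p + k *s q) = 0})"
    using ex_new_if_finite infinite_UNIV_char_0 by blast
  then show ?thesis
    by blast
qed

lemma (in frame) card_fibre_chart_point:
  "card (fibre (chart_point ` F) t) = card {a \<in> F. fst (chart_point a) = t}"
proof -
  have "fibre (chart_point ` F) t = (\<lambda>a. snd (chart_point a)) ` {a \<in> F. fst (chart_point a) = t}"
    unfolding fibre_def image_iff prod_eq_iff by auto
  moreover have "inj_on (\<lambda>a. snd (chart_point a)) {a \<in> F. fst (chart_point a) = t}"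
    using inj_chart_point by (auto simp: inj_on_def prod_eq_iff)
  ultimately show ?thesis
    by (simp add: card_image)
qed

text \<open>The vectors \<open>p\<close> and \<open>q\<close> span \<open>H\<close>, so a line other
  than \<open>H\<close> cannot contain both, and some \<open>w = p + k q\<close> avoids all the
  given lines. With \<open>u = - q\<close> the product \<open>cross u w\<close> is still
  \<open>cross p q\<close>.\<close>

lemma adapted_frame:
  fixes H :: "('k::field_char_0 ^ 3) set"
  assumes "finite A" "H \<notin> A" "proj_line H" "\<And>L. L \<in> A \<Longrightarrow> proj_line L"
  obtains u w e :: "'k ^ 3" and g where "frame u w e (g ` A)" "H = zero_set (cross u w)"
    "\<And>L. L \<in> A \<Longrightarrow> L = zero_set (g L)"
proof -
  obtain a where a: "a \<noteq> 0" "H = zero_set a"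
    using proj_line_zero_set assms(3) by blast
  obtain e where e: "dot a e = 1"
    using a(1) by (rule dot_surj)
  obtain p q where pq: "cross p q = a"
    using a(1) by (rule cross_surj)
  have "\<forall>L\<in>A. \<exists>b. b \<noteq> 0 \<and> L = zero_set b"
    using assms(4) proj_line_zero_set by blast
  then obtain f where f: "\<And>L. L \<in> A \<Longrightarrow> f L \<noteq> 0" "\<And>L. L \<in> A \<Longrightarrow> L = zero_set (f L)"
    by metis
  have "dot (f L) p \<noteq> 0 \<or> dot (f L) q \<noteq> 0" if "L \<in> A" for L
  proof (rule ccontr)
    assume "\<not> (dot (f L) p \<noteq> 0 \<or> dot (f L) q \<noteq> 0)"
    moreover have "trip p q e = 1"
      by (simp add: trip_cyclic pq e)
    ultimately have "dot (f L) x = dot (dot (f L) e *s a) x" for x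
      using dual_frame_expansion[of p q e "f L" x] pq by (simp add: dot_linear)
    then have fL: "f L = dot (f L) e *s a"
      by (rule dot_eq_imp_eq)
    have "dot (f L) e \<noteq> 0"
    proof
      assume "dot (f L) e = 0"
      then have "f L = 0"
        by (subst fL) simp
      with f(1)[OF that] show False ..
    qed
    then have "zero_set (f L) = zero_set a"
      by (subst fL) (simp add: zero_set_conv dot_linear)
    with f(2)[OF that] have "L = H"
      unfolding a(2) by (rule trans)
    with that assms(2) show False
      by simp
  qed
  with assms(1) obtain k where k: "\<And>L. L \<in> A \<Longrightarrow> dot (f L) (p + k *s q) \<noteq> 0"
    using exists_point_off_lines[of A f p q] by blast
  define w where "w = p + k *s q"
  have w: "dot (f L) w \<noteq> 0" if "L \<in> A" for L
    unfolding w_def using that by (rule k)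
  define g where "g L = (1 / dot (f L) w) *s f L" for L
  have uw: "cross (- q) w = a"
  proof -
    have "cross (- q) (p + k *s q) = cross p q"
      by (simp add: vec_eq_iff forall_3 vec3_simps algebra_simps)
    then show ?thesis
      by (simp only: w_def pq)
  qed
  show thesis
  proof (rule that)
    show "frame (- q) w e (g ` A)"
    proof
      show "trip (- q) w e = 1"
        by (simp add: trip_cyclic uw e)
      show "dot b w = 1" if "b \<in> g ` A" for b
        using that w by (auto simp: g_def dot_linear)
    qed (use assms(1) in simp)
    show "H = zero_set (cross (- q) w)"
      by (simp only: uw a(2))
    show "L = zero_set (g L)" if "L \<in> A" for L
    proof -
      have "zero_set (g L) = zero_set (f L)"
        using w[OF that] by (simp add: zero_set_conv g_def dot_linear)
      then show ?thesis
        by (rule trans[OF f(2)[OF that] sym])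
    qed
  qed
qed

section \<open>The double point on the added line\<close>

lemma subset_singleton_if_card_le_1:
  assumes "card T \<le> Suc 0" "finite T"
  shows "\<exists>t. T \<subseteq> {t}"
proof (cases "T = {}")
  case False
  then obtain t where "t \<in> T" by blast
  moreover have "\<forall>a\<in>T. \<forall>b\<in>T. a = b"
    using assms card_le_Suc0_iff_eq by blast
  ultimately show ?thesis by blast
qed simp

lemma double_point_on_added_line:
  fixes A :: "('k::field_char_0 ^ 3) set set"
  assumes A: "line_arrangement A" and H: "H \<in> A" and free: "free_arrangement (A - {H})"
  shows "\<exists>p\<in>double_points A. p \<subseteq> H"
proof (rule ccontr)
  assume none: "\<not> (\<exists>p\<in>double_points A. p \<subseteq> H)"
  have fin: "finite A" and lines: "\<And>L. L \<in> A \<Longrightarrow> proj_line L"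
    and no_centre: "\<And>p. proj_point p \<Longrightarrow> \<exists>L\<in>A. \<not> p \<subseteq> L"
    using A by (auto simp: line_arrangement_def)
  obtain u w e :: "'k ^ 3" and g where "frame u w e (g ` (A - {H}))"
    and H0: "H = zero_set (cross u w)" and g: "\<And>L. L \<in> A - {H} \<Longrightarrow> L = zero_set (g L)"
    by (rule adapted_frame[of "A - {H}" H]) (use fin lines H in auto)
  then interpret frame u w e "g ` (A - {H})"
    by simp
  \<comment> \<open>These are the points of \<open>H\<close> other than \<open>w\<close>. As
    \<open>w\<close> lies on no other line, they include every intersection with one.\<close>
  define P where "P t = vec.span {u + t *s w}" for t
  have inj_g: "inj_on g (A - {H})"
    using g by (metis inj_onI)
  have point: "proj_point (P t)" for t
  proof -
    have "dot (cross w e) (u + t *s w) = trip u w e"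
      by (simp add: vec3_simps algebra_simps)
    then have "u + t *s w \<noteq> 0"
      using trip_frame dot_zero by (metis zero_neq_one)
    then show ?thesis
      unfolding P_def by (rule proj_point_span)
  qed
  have P_H: "P t \<subseteq> H" for t
    using span_subset_line[OF lines[OF H], of "u + t *s w"]
    by (simp add: P_def H0 zero_set_conv vec3_simps algebra_simps)
  have P_L: "P t \<subseteq> L \<longleftrightarrow> fst (chart_point (g L)) = t" if L: "L \<in> A - {H}" for t L
  proof -
    have "u + t *s w \<in> L \<longleftrightarrow> dot (g L) (u + t *s w) = 0"
      by (subst g[OF L]) (simp add: zero_set_conv)
    then show ?thesis
      using span_subset_line[OF lines, of L "u + t *s w"] L normalised[of "g L"]
      by (auto simp: P_def dot_linear dot_scale chart_point_def add_eq_0_iff)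
  qed
  \<comment> \<open>The successor counts \<open>H\<close> itself, so \<open>P t\<close> is a double
    point exactly if the fibre has one element.\<close>
  have card_P: "card {L \<in> A. P t \<subseteq> L} = Suc (card (fibre (chart_point ` g ` (A - {H})) t))" for t
  proof -
    have "{L \<in> A. P t \<subseteq> L} = insert H {L \<in> A - {H}. fst (chart_point (g L)) = t}"
    proof (intro set_eqI iffI)
      fix L assume "L \<in> insert H {L \<in> A - {H}. fst (chart_point (g L)) = t}"
      then show "L \<in> {L \<in> A. P t \<subseteq> L}"
        using H P_H[of t] P_L[of L t] by blast
    next
      fix L assume "L \<in> {L \<in> A. P t \<subseteq> L}"
      then show "L \<in> insert H {L \<in> A - {H}. fst (chart_point (g L)) = t}"
        using P_L[of L t] by blast
    qed
    moreover have "{a \<in> g ` (A - {H}). fst (chart_point a) = t} =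
        g ` {L \<in> A - {H}. fst (chart_point (g L)) = t}"
      by blast
    moreover have "card (g ` {L \<in> A - {H}. fst (chart_point (g L)) = t}) =
        card {L \<in> A - {H}. fst (chart_point (g L)) = t}"
      by (intro card_image inj_on_subset[OF inj_g]) auto
    ultimately show ?thesis
      using fin by (simp add: card_fibre_chart_point)
  qed
  have mult: "card (fibre (chart_point ` g ` (A - {H})) t) \<ge> 2"
    if t: "t \<in> fst ` chart_point ` g ` (A - {H})" for t
  proof -
    obtain L where L: "L \<in> A - {H}" "fst (chart_point (g L)) = t"
      using t by blast
    have "L \<in> A" "L \<noteq> H" "P t \<subseteq> L"
      using L P_L[OF L(1)] by simp_all
    then have "P t \<in> L2 A"
      unfolding L2_def using point[of t] P_H[of t] H by blast
    moreover have "P t \<notin> double_points A"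
      using none P_H[of t] by blast
    ultimately have "card {L \<in> A. P t \<subseteq> L} \<noteq> 2"
      by (simp add: double_points_def)
    moreover have "snd (chart_point (g L)) \<in> fibre (chart_point ` g ` (A - {H})) t"
      unfolding fibre_def L(2)[symmetric] using L(1) by simp
    then have "card (fibre (chart_point ` g ` (A - {H})) t) \<noteq> 0"
      using finite_fibre[of "chart_point ` g ` (A - {H})" t] fin by auto
    ultimately show ?thesis
      by (simp add: card_P)
  qed
  \<comment> \<open>Otherwise all lines, \<open>H\<close> included, pass through one point
    \<open>P t\<close>; this covers the case \<open>A = {H}\<close> as well.\<close>
  have "card (fst ` chart_point ` g ` (A - {H})) \<ge> 2"
  proof (rule ccontr)
    assume "\<not> card (fst ` chart_point ` g ` (A - {H})) \<ge> 2"
    then have "card (fst ` chart_point ` g ` (A - {H})) \<le> Suc 0"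
      by simp
    moreover have "finite (fst ` chart_point ` g ` (A - {H}))"
      using fin by simp
    ultimately obtain t where "fst ` chart_point ` g ` (A - {H}) \<subseteq> {t}"
      using subset_singleton_if_card_le_1 by blast
    then have "P t \<subseteq> L" if "L \<in> A" for L
    proof (cases "L = H")
      case False
      with that have "L \<in> A - {H}"
        by simp
      with \<open>_ \<subseteq> {t}\<close> P_L[OF this, of t] show ?thesis
        by blast
    qed (use P_H[of t] in simp)
    then show False
      using no_centre[OF point] by blast
  qed
  then have "\<not> free_submodule (log_module (g ` (A - {H})))"
    using mult by (rule not_free_if_multiplicities_ge_2)
  moreover have "log_der (A - {H}) = log_module (g ` (A - {H}))"
    by (rule log_der_eq_log_module[where w = w]) (rule g, assumption, rule normalised, rule imageI)
  ultimately show False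
    using free by (simp only: free_arrangement_def)
qed

theorem theorem1p7:
  fixes A :: "('k::field_char_0 ^ 3) set set"
    and H :: "('k ^ 3) set"
  assumes "line_arrangement A"
    and "H \<in> A"
    and "free_arrangement (A - {H})"
  shows "n2 A \<ge> n2_on A H \<and> n2_on A H > 0"
proof
  have fin: "finite (double_points A)"
    using assms(1) by (intro finite_double_points) (auto simp: line_arrangement_def)
  then show "n2 A \<ge> n2_on A H"
    unfolding n2_def n2_on_def by (intro card_mono) auto
  show "n2_on A H > 0"
    using double_point_on_added_line[OF assms] fin by (auto simp: n2_on_def card_gt_0_iff)
qed

end
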